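(* Let $K$ be an algebraically closed field, $G$ a finite group, $D=D(G)$ the Drinfel'd double of $G$ over $K$, and let $W$ be a $D$-module. Then, for all $m\ge0$, $$\mathrm{Ext}_D^m(K,W)\cong H^m(G,W_e)$$ as $K$-vector spaces.
   Context: $e$ is the unit of $G$. $D=D(G)$ is the Hopf algebra with basis $\delta_a\otimes b$ ($a,b\in G$), product $(\delta_a\otimes b)(\delta_c\otimes d)=\delta_{a,bcb^{-1}}\,\delta_a\otimes bd$ (with $\delta_{a,bcb^{-1}}$ the Kronecker symbol), unit $\varepsilon\otimes e$ where $\varepsilon=\sum_{a\in G}\delta_a$, coproduct $\Delta(\delta_a\otimes b)=\sum_{c}(\delta_c\otimes b)\otimes(\delta_{ac^{-1}}\otimes b)$ and counit $\delta_a\otimes b\mapsto\delta_{a,e}$. $K$ is the trivial $D$-module via the counit. For a $D$-module $W$, $W_e=\{w\in W\mid(\delta_e\otimes e).w=w\}$, which is a $K[G]$-module via $b.w=(\varepsilon\otimes b).w$. $H^m(G,-)=\mathrm{Ext}^m_{K[G]}(K,-)$ is group cohomology. *)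

theory Defs
  imports "HOL-Algebra.Algebra"
begin

section \<open>Modules over a not necessarily commutative ring\<close>

text \<open>
  The locale \<^locale>\<open>module\<close> requires a commutative ring of scalars; the following is the same
  set of axioms for left modules over an arbitrary ring. As in \<^locale>\<open>module\<close>, the multiplicative
  fields of the record \<open>M\<close> are irrelevant.
\<close>

locale left_module = A?: ring A + M?: abelian_group M
  for A :: "('a, 'c) ring_scheme" (structure) and M :: "('a, 'm, 'd) module_scheme" (structure) +
  assumes smult_closed [simp, intro]:
      "\<lbrakk>a \<in> carrier A; x \<in> carrier M\<rbrakk> \<Longrightarrow> a \<odot>\<^bsub>M\<^esub> x \<in> carrier M"
    and smult_l_distr:
      "\<lbrakk>a \<in> carrier A; b \<in> carrier A; x \<in> carrier M\<rbrakk> \<Longrightarrow>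
        (a \<oplus>\<^bsub>A\<^esub> b) \<odot>\<^bsub>M\<^esub> x = a \<odot>\<^bsub>M\<^esub> x \<oplus>\<^bsub>M\<^esub> b \<odot>\<^bsub>M\<^esub> x"
    and smult_r_distr:
      "\<lbrakk>a \<in> carrier A; x \<in> carrier M; y \<in> carrier M\<rbrakk> \<Longrightarrow>
        a \<odot>\<^bsub>M\<^esub> (x \<oplus>\<^bsub>M\<^esub> y) = a \<odot>\<^bsub>M\<^esub> x \<oplus>\<^bsub>M\<^esub> a \<odot>\<^bsub>M\<^esub> y"
    and smult_assoc:
      "\<lbrakk>a \<in> carrier A; b \<in> carrier A; x \<in> carrier M\<rbrakk> \<Longrightarrow>
        (a \<otimes>\<^bsub>A\<^esub> b) \<odot>\<^bsub>M\<^esub> x = a \<odot>\<^bsub>M\<^esub> (b \<odot>\<^bsub>M\<^esub> x)"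
    and smult_one [simp]:
      "x \<in> carrier M \<Longrightarrow> \<one>\<^bsub>A\<^esub> \<odot>\<^bsub>M\<^esub> x = x"

definition linear_map ::
  "('a, 'c) ring_scheme \<Rightarrow> ('a, 'm, 'd) module_scheme \<Rightarrow> ('a, 'n, 'e) module_scheme \<Rightarrow> ('m \<Rightarrow> 'n) \<Rightarrow> bool"
  where "linear_map A M N f \<longleftrightarrow>
    f \<in> carrier M \<rightarrow> carrier N \<and>
    (\<forall>x\<in>carrier M. \<forall>y\<in>carrier M. f (x \<oplus>\<^bsub>M\<^esub> y) = f x \<oplus>\<^bsub>N\<^esub> f y) \<and>
    (\<forall>a\<in>carrier A. \<forall>x\<in>carrier M. f (a \<odot>\<^bsub>M\<^esub> x) = a \<odot>\<^bsub>N\<^esub> f x)"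

definition isomorphic_modules ::
  "('a, 'c) ring_scheme \<Rightarrow> ('a, 'm, 'd) module_scheme \<Rightarrow> ('a, 'n, 'e) module_scheme \<Rightarrow> bool"
  where "isomorphic_modules A M N \<longleftrightarrow>
    (\<exists>f. linear_map A M N f \<and> bij_betw f (carrier M) (carrier N))"

text \<open>
  Projectivity by the lifting property. The test surjections \<open>g: M \<rightarrow> N\<close> have to range over fixed
  types. The types chosen here lose nothing: the functions of type \<open>'p \<Rightarrow> 'a\<close> with finite support
  contain the free module on the set \<open>carrier P\<close>, so the test includes the canonical surjection of
  that free module onto \<open>P\<close>; hence \<open>P\<close> is a direct summand of a free module and lifts against
  surjections between modules of arbitrary types (lemma \<open>projective_lift\<close> below).
\<close>

definition projective :: "('a, 'c) ring_scheme \<Rightarrow> ('a, 'p) module \<Rightarrow> bool"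
  where "projective A P \<longleftrightarrow> left_module A P \<and>
    (\<forall>(M :: ('a, 'p \<Rightarrow> 'a) module) (N :: ('a, 'p) module) g f.
      left_module A M \<and> left_module A N \<and>
      linear_map A M N g \<and> g ` carrier M = carrier N \<and> linear_map A P N f \<longrightarrow>
      (\<exists>h. linear_map A P M h \<and> (\<forall>x\<in>carrier P. g (h x) = f x)))"

text \<open>\<open>\<dots> \<rightarrow> P 2 \<rightarrow> P 1 \<rightarrow> P 0 \<rightarrow> M \<rightarrow> 0\<close> is exact, with \<open>d n: P (n + 1) \<rightarrow> P n\<close> and \<open>p: P 0 \<rightarrow> M\<close>.\<close>

definition projective_resolution ::
  "('a, 'c) ring_scheme \<Rightarrow> ('a, 'm) module \<Rightarrow>
    (nat \<Rightarrow> ('a, 'p) module) \<Rightarrow> (nat \<Rightarrow> 'p \<Rightarrow> 'p) \<Rightarrow> ('p \<Rightarrow> 'm) \<Rightarrow> bool"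
  where "projective_resolution A M P d p \<longleftrightarrow>
    left_module A M \<and>
    (\<forall>n. projective A (P n)) \<and>
    linear_map A (P 0) M p \<and>
    (\<forall>n. linear_map A (P (Suc n)) (P n) (d n)) \<and>
    p ` carrier (P 0) = carrier M \<and>
    d 0 ` carrier (P 1) = {x \<in> carrier (P 0). p x = \<zero>\<^bsub>M\<^esub>} \<and>
    (\<forall>n. d (Suc n) ` carrier (P (Suc (Suc n))) = {x \<in> carrier (P (Suc n)). d n x = \<zero>\<^bsub>P n\<^esub>})"


section \<open>Ext over a \<open>K\<close>-algebra\<close>

text \<open>
  A \<open>K\<close>-algebra is a record \<open>A\<close> of type \<open>('k, 'a) module\<close>: its ring fields are the ring structure
  and its field \<^const>\<open>smult\<close> is the \<open>K\<close>-action. An \<open>A\<close>-module is a \<open>K\<close>-vector space via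
  \<open>k.w = (k.1).w\<close>. Linear maps are identified when they agree on the carrier, so the elements of
  \<open>Hom\<close> are taken to be extensional.
\<close>

definition Hom_space ::
  "('k, 'a) module \<Rightarrow> ('a, 'm) module \<Rightarrow> ('a, 'n) module \<Rightarrow> ('k, 'm \<Rightarrow> 'n) module"
  where "Hom_space A M N =
    \<lparr>carrier = {f \<in> extensional (carrier M). linear_map A M N f},
     monoid.mult = undefined,
     one = undefined,
     ring.zero = (\<lambda>x\<in>carrier M. \<zero>\<^bsub>N\<^esub>),
     add = (\<lambda>f g. \<lambda>x\<in>carrier M. f x \<oplus>\<^bsub>N\<^esub> g x),
     smult = (\<lambda>k f. \<lambda>x\<in>carrier M. (k \<odot>\<^bsub>A\<^esub> \<one>\<^bsub>A\<^esub>) \<odot>\<^bsub>N\<^esub> f x)\<rparr>"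

definition quotient_module :: "('k, 'v) module \<Rightarrow> 'v set \<Rightarrow> ('k, 'v set) module"
  where "quotient_module V B =
    \<lparr>carrier = a_rcosets\<^bsub>V\<^esub> B,
     monoid.mult = undefined,
     one = undefined,
     ring.zero = B,
     add = (\<lambda>C D. C <+>\<^bsub>V\<^esub> D),
     smult = (\<lambda>k C. \<Union>x\<in>C. B +>\<^bsub>V\<^esub> (k \<odot>\<^bsub>V\<^esub> x))\<rparr>"

definition cocycles ::
  "('k, 'a) module \<Rightarrow> (nat \<Rightarrow> ('a, 'p) module) \<Rightarrow> (nat \<Rightarrow> 'p \<Rightarrow> 'p) \<Rightarrow> ('a, 'w) module \<Rightarrow> nat \<Rightarrow>
    ('p \<Rightarrow> 'w) set"
  where "cocycles A P d W m =
    {f \<in> carrier (Hom_space A (P m) W). \<forall>x\<in>carrier (P (Suc m)). f (d m x) = \<zero>\<^bsub>W\<^esub>}"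

primrec coboundaries ::
  "('k, 'a) module \<Rightarrow> (nat \<Rightarrow> ('a, 'p) module) \<Rightarrow> (nat \<Rightarrow> 'p \<Rightarrow> 'p) \<Rightarrow> ('a, 'w) module \<Rightarrow> nat \<Rightarrow>
    ('p \<Rightarrow> 'w) set"
  where
    "coboundaries A P d W 0 = {\<zero>\<^bsub>Hom_space A (P 0) W\<^esub>}"
  | "coboundaries A P d W (Suc m) =
      (\<lambda>g. compose (carrier (P (Suc m))) g (d m)) ` carrier (Hom_space A (P m) W)"

text \<open>
  For a projective resolution \<open>(P, d, p)\<close> of an \<open>A\<close>-module \<open>M\<close>, the \<open>K\<close>-vector space \<open>Ext A P d W m\<close>
  is the \<open>m\<close>-th cohomology of the complex of \<open>Hom\<close> spaces from \<open>P\<close> to \<open>W\<close>, that is, the \<open>m\<close>-th Ext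
  space of \<open>M\<close> and \<open>W\<close> over \<open>A\<close>. The resolution is kept as a parameter, and statements about Ext are
  to be made for every projective resolution; every module has one (lemma
  \<open>projective_resolution_exists\<close> below).
\<close>

definition Ext ::
  "('k, 'a) module \<Rightarrow> (nat \<Rightarrow> ('a, 'p) module) \<Rightarrow> (nat \<Rightarrow> 'p \<Rightarrow> 'p) \<Rightarrow> ('a, 'w) module \<Rightarrow> nat \<Rightarrow>
    ('k, ('p \<Rightarrow> 'w) set) module"
  where "Ext A P d W m =
    quotient_module ((Hom_space A (P m) W)\<lparr>carrier := cocycles A P d W m\<rparr>) (coboundaries A P d W m)"


section \<open>The Drinfel'd double and the group algebra\<close>

text \<open>
  The \<open>K\<close>-algebra with basis a finite set \<open>S\<close>; an element is the function giving its coefficients,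
  and \<open>c s t r\<close> is the coefficient of \<open>r\<close> in the product of the basis elements \<open>s\<close> and \<open>t\<close>.
\<close>

definition based_algebra ::
  "('k, 'r) ring_scheme \<Rightarrow> 'x set \<Rightarrow> ('x \<Rightarrow> 'x \<Rightarrow> 'x \<Rightarrow> 'k) \<Rightarrow> ('x \<Rightarrow> 'k) \<Rightarrow> ('k, 'x \<Rightarrow> 'k) module"
  where "based_algebra K S c u =
    \<lparr>carrier = S \<rightarrow>\<^sub>E carrier K,
     monoid.mult = (\<lambda>x y. \<lambda>r\<in>S. \<Oplus>\<^bsub>K\<^esub>p\<in>S \<times> S.
               x (fst p) \<otimes>\<^bsub>K\<^esub> y (snd p) \<otimes>\<^bsub>K\<^esub> c (fst p) (snd p) r),
     one = u,
     ring.zero = (\<lambda>r\<in>S. \<zero>\<^bsub>K\<^esub>),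
     add = (\<lambda>x y. \<lambda>r\<in>S. x r \<oplus>\<^bsub>K\<^esub> y r),
     smult = (\<lambda>k x. \<lambda>r\<in>S. k \<otimes>\<^bsub>K\<^esub> x r)\<rparr>"

text \<open>The pair \<open>(a, b)\<close> stands for the basis element \<open>\<delta>\<^sub>a \<otimes> b\<close> of \<open>D(G)\<close>.\<close>

definition drinfeld_double ::
  "('k, 'r) ring_scheme \<Rightarrow> ('g, 's) monoid_scheme \<Rightarrow> ('k, 'g \<times> 'g \<Rightarrow> 'k) module"
  where "drinfeld_double K G =
    based_algebra K (carrier G \<times> carrier G)
      (\<lambda>(a, b) (c, d) r.
        if a = b \<otimes>\<^bsub>G\<^esub> c \<otimes>\<^bsub>G\<^esub> inv\<^bsub>G\<^esub> b \<and> r = (a, b \<otimes>\<^bsub>G\<^esub> d) then \<one>\<^bsub>K\<^esub> else \<zero>\<^bsub>K\<^esub>)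
      (\<lambda>(a, b)\<in>carrier G \<times> carrier G. if b = \<one>\<^bsub>G\<^esub> then \<one>\<^bsub>K\<^esub> else \<zero>\<^bsub>K\<^esub>)"

definition double_counit ::
  "('k, 'r) ring_scheme \<Rightarrow> ('g, 's) monoid_scheme \<Rightarrow> ('g \<times> 'g \<Rightarrow> 'k) \<Rightarrow> 'k"
  where "double_counit K G x =
    (\<Oplus>\<^bsub>K\<^esub>p\<in>carrier G \<times> carrier G. x p \<otimes>\<^bsub>K\<^esub> (if fst p = \<one>\<^bsub>G\<^esub> then \<one>\<^bsub>K\<^esub> else \<zero>\<^bsub>K\<^esub>))"

definition group_algebra ::
  "('k, 'r) ring_scheme \<Rightarrow> ('g, 's) monoid_scheme \<Rightarrow> ('k, 'g \<Rightarrow> 'k) module"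
  where "group_algebra K G =
    based_algebra K (carrier G)
      (\<lambda>g h r. if r = g \<otimes>\<^bsub>G\<^esub> h then \<one>\<^bsub>K\<^esub> else \<zero>\<^bsub>K\<^esub>)
      (\<lambda>g\<in>carrier G. if g = \<one>\<^bsub>G\<^esub> then \<one>\<^bsub>K\<^esub> else \<zero>\<^bsub>K\<^esub>)"

definition group_counit ::
  "('k, 'r) ring_scheme \<Rightarrow> ('g, 's) monoid_scheme \<Rightarrow> ('g \<Rightarrow> 'k) \<Rightarrow> 'k"
  where "group_counit K G x = (\<Oplus>\<^bsub>K\<^esub>g\<in>carrier G. x g)"

text \<open>\<open>K\<close> as a module over an algebra with counit \<open>\<eta>\<close>, that is, \<open>x.k = \<eta>(x) k\<close>.\<close>

definition trivial_module :: "('k, 'r) ring_scheme \<Rightarrow> ('a \<Rightarrow> 'k) \<Rightarrow> ('a, 'k) module"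
  where "trivial_module K \<eta> =
    \<lparr>carrier = carrier K,
     monoid.mult = monoid.mult K,
     one = \<one>\<^bsub>K\<^esub>,
     ring.zero = \<zero>\<^bsub>K\<^esub>,
     add = add K,
     smult = (\<lambda>x k. \<eta> x \<otimes>\<^bsub>K\<^esub> k)\<rparr>"

definition double_trivial ::
  "('k, 'r) ring_scheme \<Rightarrow> ('g, 's) monoid_scheme \<Rightarrow> ('g \<times> 'g \<Rightarrow> 'k, 'k) module"
  where "double_trivial K G = trivial_module K (double_counit K G)"

definition group_trivial ::
  "('k, 'r) ring_scheme \<Rightarrow> ('g, 's) monoid_scheme \<Rightarrow> ('g \<Rightarrow> 'k, 'k) module"
  where "group_trivial K G = trivial_module K (group_counit K G)"

definition double_basis ::
  "('k, 'r) ring_scheme \<Rightarrow> ('g, 's) monoid_scheme \<Rightarrow> 'g \<Rightarrow> 'g \<Rightarrow> 'g \<times> 'g \<Rightarrow> 'k"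
  where "double_basis K G a b =
    (\<lambda>p\<in>carrier G \<times> carrier G. if p = (a, b) then \<one>\<^bsub>K\<^esub> else \<zero>\<^bsub>K\<^esub>)"

text \<open>
  The \<open>K\<close>-linear extension of \<open>b \<mapsto> \<epsilon> \<otimes> b = \<Sum>\<^sub>a \<delta>\<^sub>a \<otimes> b\<close> from \<open>K[G]\<close> to \<open>D(G)\<close>: the coefficient of
  \<open>\<delta>\<^sub>a \<otimes> b\<close> in the image of \<open>x\<close> is \<open>x b\<close>.
\<close>

definition group_to_double ::
  "('g, 's) monoid_scheme \<Rightarrow> ('g \<Rightarrow> 'k) \<Rightarrow> 'g \<times> 'g \<Rightarrow> 'k"
  where "group_to_double G x = (\<lambda>(a, b)\<in>carrier G \<times> carrier G. x b)"

definition unit_component ::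
  "('k, 'r) ring_scheme \<Rightarrow> ('g, 's) monoid_scheme \<Rightarrow> ('g \<times> 'g \<Rightarrow> 'k, 'w) module \<Rightarrow> ('g \<Rightarrow> 'k, 'w) module"
  where "unit_component K G W =
    \<lparr>carrier = {w \<in> carrier W. double_basis K G \<one>\<^bsub>G\<^esub> \<one>\<^bsub>G\<^esub> \<odot>\<^bsub>W\<^esub> w = w},
     monoid.mult = monoid.mult W,
     one = \<one>\<^bsub>W\<^esub>,
     ring.zero = \<zero>\<^bsub>W\<^esub>,
     add = add W,
     smult = (\<lambda>x w. group_to_double G x \<odot>\<^bsub>W\<^esub> w)\<rparr>"

text \<open>Here \<open>(Q, d, q)\<close> is a projective resolution of the trivial \<open>K[G]\<close>-module.\<close>

definition group_cohomology ::
  "('k, 'r) ring_scheme \<Rightarrow> ('g, 's) monoid_scheme \<Rightarrow> (nat \<Rightarrow> ('g \<Rightarrow> 'k, 'q) module) \<Rightarrow>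
    (nat \<Rightarrow> 'q \<Rightarrow> 'q) \<Rightarrow> ('g \<Rightarrow> 'k, 'v) module \<Rightarrow> nat \<Rightarrow> ('k, ('q \<Rightarrow> 'v) set) module"
  where "group_cohomology K G Q d V m = Ext (group_algebra K G) Q d V m"


section \<open>Existence of projective resolutions\<close>

definition free_module :: "('a, 'c) ring_scheme \<Rightarrow> 'x set \<Rightarrow> ('a, 'x \<Rightarrow> 'a) module"
  where "free_module A S =
    \<lparr>carrier = {u. (\<forall>x. u x \<in> carrier A) \<and> finite {x. u x \<noteq> \<zero>\<^bsub>A\<^esub>} \<and> (\<forall>x. x \<notin> S \<longrightarrow> u x = \<zero>\<^bsub>A\<^esub>)},
     monoid.mult = undefined,
     one = undefined,
     ring.zero = (\<lambda>x. \<zero>\<^bsub>A\<^esub>),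
     add = (\<lambda>u v x. u x \<oplus>\<^bsub>A\<^esub> v x),
     smult = (\<lambda>a u x. a \<otimes>\<^bsub>A\<^esub> u x)\<rparr>"

definition free_basis :: "('a, 'c) ring_scheme \<Rightarrow> 'x \<Rightarrow> 'x \<Rightarrow> 'a"
  where "free_basis A x = (\<lambda>y. if y = x then \<one>\<^bsub>A\<^esub> else \<zero>\<^bsub>A\<^esub>)"

definition free_lift ::
  "('a, 'c) ring_scheme \<Rightarrow> ('a, 'm) module \<Rightarrow> ('x \<Rightarrow> 'm) \<Rightarrow> ('x \<Rightarrow> 'a) \<Rightarrow> 'm"
  where "free_lift A M \<phi> u = (\<Oplus>\<^bsub>M\<^esub>x\<in>{x. u x \<noteq> \<zero>\<^bsub>A\<^esub>}. u x \<odot>\<^bsub>M\<^esub> \<phi> x)"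

lemma linear_mapD:
  assumes "linear_map A M N f"
  shows "x \<in> carrier M \<Longrightarrow> f x \<in> carrier N"
    and "x \<in> carrier M \<Longrightarrow> y \<in> carrier M \<Longrightarrow> f (x \<oplus>\<^bsub>M\<^esub> y) = f x \<oplus>\<^bsub>N\<^esub> f y"
    and "a \<in> carrier A \<Longrightarrow> x \<in> carrier M \<Longrightarrow> f (a \<odot>\<^bsub>M\<^esub> x) = a \<odot>\<^bsub>N\<^esub> f x"
  using assms by (auto simp: linear_map_def)

lemma (in left_module) smult_l_null: "x \<in> carrier M \<Longrightarrow> \<zero>\<^bsub>A\<^esub> \<odot>\<^bsub>M\<^esub> x = \<zero>\<^bsub>M\<^esub>"
  by (metis A.zero_closed A.l_zero M.add.r_cancel_one' smult_closed smult_l_distr)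

lemma (in left_module) smult_r_null: "a \<in> carrier A \<Longrightarrow> a \<odot>\<^bsub>M\<^esub> \<zero>\<^bsub>M\<^esub> = \<zero>\<^bsub>M\<^esub>"
  by (metis M.zero_closed M.l_zero M.add.r_cancel_one' smult_closed smult_r_distr)

lemma linear_map_zero:
  assumes "left_module A M" "left_module A N" "linear_map A M N f"
  shows "f \<zero>\<^bsub>M\<^esub> = \<zero>\<^bsub>N\<^esub>"
proof -
  interpret M: left_module A M by fact
  interpret N: left_module A N by fact
  have "f \<zero>\<^bsub>M\<^esub> = f (\<zero>\<^bsub>A\<^esub> \<odot>\<^bsub>M\<^esub> \<zero>\<^bsub>M\<^esub>)" by (simp add: M.smult_l_null)
  also have "\<dots> = \<zero>\<^bsub>A\<^esub> \<odot>\<^bsub>N\<^esub> f \<zero>\<^bsub>M\<^esub>" using linear_mapD[OF assms(3)] by simp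
  also have "\<dots> = \<zero>\<^bsub>N\<^esub>" using linear_mapD[OF assms(3)] by (simp add: N.smult_l_null)
  finally show ?thesis .
qed

lemma linear_map_comp:
  assumes "linear_map A M N f" "linear_map A N L g"
  shows "linear_map A M L (\<lambda>x. g (f x))"
  using assms by (auto simp: linear_map_def Pi_iff)

lemma left_module_free_module:
  fixes A :: "('a, 'c) ring_scheme" and S :: "'x set"
  assumes "ring A"
  shows "left_module A (free_module A S)"
proof -
  interpret A: ring A by fact
  have supp: "finite {x. u x \<oplus>\<^bsub>A\<^esub> v x \<noteq> \<zero>\<^bsub>A\<^esub>}"
    if "finite {x. u x \<noteq> \<zero>\<^bsub>A\<^esub>}" "finite {x. v x \<noteq> \<zero>\<^bsub>A\<^esub>}" for u v :: "'x \<Rightarrow> 'a"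
    by (rule finite_subset[OF _ finite_UnI[OF that]]) auto
  have supp2: "finite {x. a \<otimes>\<^bsub>A\<^esub> u x \<noteq> \<zero>\<^bsub>A\<^esub>}"
    if "finite {x. u x \<noteq> \<zero>\<^bsub>A\<^esub>}" "a \<in> carrier A" for a and u :: "'x \<Rightarrow> 'a"
    using that(2) by (intro finite_subset[OF _ that(1)]) auto
  have neg: "finite {x. \<ominus>\<^bsub>A\<^esub> u x \<noteq> \<zero>\<^bsub>A\<^esub>}" if "finite {x. u x \<noteq> \<zero>\<^bsub>A\<^esub>}" for u :: "'x \<Rightarrow> 'a"
    by (rule finite_subset[OF _ that]) auto
  show ?thesis
  proof (intro left_module.intro left_module_axioms.intro abelian_groupI assms)
    fix u assume "u \<in> carrier (free_module A S)"
    then show "\<exists>v\<in>carrier (free_module A S). v \<oplus>\<^bsub>free_module A S\<^esub> u = \<zero>\<^bsub>free_module A S\<^esub>"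
      by (intro bexI[of _ "\<lambda>x. \<ominus>\<^bsub>A\<^esub> u x"]) (auto simp: free_module_def neg A.l_neg)
  qed (auto simp: free_module_def supp supp2 fun_eq_iff
        A.a_assoc A.l_distr A.r_distr A.m_assoc intro: A.a_comm)
qed

lemma free_module_simps:
  "u \<in> carrier (free_module A S) \<longleftrightarrow>
    (\<forall>x. u x \<in> carrier A) \<and> finite {x. u x \<noteq> \<zero>\<^bsub>A\<^esub>} \<and> (\<forall>x. x \<notin> S \<longrightarrow> u x = \<zero>\<^bsub>A\<^esub>)"
  "\<zero>\<^bsub>free_module A S\<^esub> = (\<lambda>x. \<zero>\<^bsub>A\<^esub>)"
  "u \<oplus>\<^bsub>free_module A S\<^esub> v = (\<lambda>x. u x \<oplus>\<^bsub>A\<^esub> v x)"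
  "a \<odot>\<^bsub>free_module A S\<^esub> u = (\<lambda>x. a \<otimes>\<^bsub>A\<^esub> u x)"
  by (auto simp: free_module_def)

lemma free_basis_closed:
  assumes "ring A" "x \<in> S"
  shows "free_basis A x \<in> carrier (free_module A S)"
proof -
  interpret A: ring A by fact
  have "{y. free_basis A x y \<noteq> \<zero>\<^bsub>A\<^esub>} \<subseteq> {x}" by (auto simp: free_basis_def)
  then have "finite {y. free_basis A x y \<noteq> \<zero>\<^bsub>A\<^esub>}" using finite_subset by blast
  then show ?thesis using assms(2) by (auto simp: free_module_simps free_basis_def)
qed

lemma free_lift_superset:
  assumes M: "left_module A M" and u: "u \<in> carrier (free_module A S)"
    and \<phi>: "\<phi> \<in> S \<rightarrow> carrier M"
    and T: "finite T" "T \<subseteq> S" "{x. u x \<noteq> \<zero>\<^bsub>A\<^esub>} \<subseteq> T"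
  shows "free_lift A M \<phi> u = (\<Oplus>\<^bsub>M\<^esub>x\<in>T. u x \<odot>\<^bsub>M\<^esub> \<phi> x)"
proof -
  interpret M: left_module A M by fact
  show ?thesis
    unfolding free_lift_def
    using assms
    by (intro M.add.finprod_mono_neutral_cong_left)
      (auto simp: free_module_simps M.smult_l_null Pi_iff)
qed

lemma (in left_module) finsum_smult:
  assumes "a \<in> carrier A" "finite T" "f \<in> T \<rightarrow> carrier M"
  shows "(\<Oplus>\<^bsub>M\<^esub>x\<in>T. a \<odot>\<^bsub>M\<^esub> f x) = a \<odot>\<^bsub>M\<^esub> (\<Oplus>\<^bsub>M\<^esub>x\<in>T. f x)"
  using assms(2,3)
proof (induction T rule: finite_induct)
  case empty
  then show ?case using assms(1) by (simp add: smult_r_null)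
next
  case (insert x T)
  then have f: "f \<in> T \<rightarrow> carrier M" and x: "f x \<in> carrier M" by auto
  then have af: "(\<lambda>x. a \<odot>\<^bsub>M\<^esub> f x) \<in> T \<rightarrow> carrier M" "a \<odot>\<^bsub>M\<^esub> f x \<in> carrier M"
    using assms(1) by auto
  show ?case
    unfolding M.finsum_insert[OF insert.hyps f x] M.finsum_insert[OF insert.hyps af] insert.IH[OF f]
    by (rule smult_r_distr[OF assms(1) x M.finsum_closed[OF f], symmetric])
qed

lemma linear_map_free_lift:
  assumes M: "left_module A M" and \<phi>: "\<phi> \<in> S \<rightarrow> carrier M"
  shows "linear_map A (free_module A S) M (free_lift A M \<phi>)"
proof -
  interpret M: left_module A M by fact
  interpret F: left_module A "free_module A S" by (rule left_module_free_module) unfold_locales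
  have supp: "finite {x. u x \<noteq> \<zero>\<^bsub>A\<^esub>}" "{x. u x \<noteq> \<zero>\<^bsub>A\<^esub>} \<subseteq> S"
    if "u \<in> carrier (free_module A S)" for u
    using that by (auto simp: free_module_simps)
  have closed: "u x \<odot>\<^bsub>M\<^esub> \<phi> x \<in> carrier M" if "u \<in> carrier (free_module A S)" "x \<in> S" for u x
    using that \<phi> by (auto simp: free_module_simps)
  have 1: "free_lift A M \<phi> u \<in> carrier M" if "u \<in> carrier (free_module A S)" for u
    unfolding free_lift_def using supp[OF that] closed[OF that]
    by (intro M.finsum_closed) auto
  have 2: "free_lift A M \<phi> (u \<oplus>\<^bsub>free_module A S\<^esub> v) = free_lift A M \<phi> u \<oplus>\<^bsub>M\<^esub> free_lift A M \<phi> v"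
    if u: "u \<in> carrier (free_module A S)" and v: "v \<in> carrier (free_module A S)" for u v
  proof -
    let ?w = "u \<oplus>\<^bsub>free_module A S\<^esub> v"
    let ?T = "{x. u x \<noteq> \<zero>\<^bsub>A\<^esub>} \<union> {x. v x \<noteq> \<zero>\<^bsub>A\<^esub>}"
    have T: "finite ?T" "?T \<subseteq> S" using supp[OF u] supp[OF v] by auto
    have w: "?w \<in> carrier (free_module A S)" using u v by (rule F.M.a_closed)
    have "free_lift A M \<phi> ?w = (\<Oplus>\<^bsub>M\<^esub>x\<in>?T. ?w x \<odot>\<^bsub>M\<^esub> \<phi> x)"
      by (rule free_lift_superset[OF M w \<phi> T]) (auto simp: free_module_simps)
    also have "\<dots> = (\<Oplus>\<^bsub>M\<^esub>x\<in>?T. u x \<odot>\<^bsub>M\<^esub> \<phi> x \<oplus>\<^bsub>M\<^esub> v x \<odot>\<^bsub>M\<^esub> \<phi> x)"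
    proof (rule M.finsum_cong')
      show "(\<lambda>x. u x \<odot>\<^bsub>M\<^esub> \<phi> x \<oplus>\<^bsub>M\<^esub> v x \<odot>\<^bsub>M\<^esub> \<phi> x) \<in> ?T \<rightarrow> carrier M"
        using closed[OF u] closed[OF v] T(2) by auto
      fix x assume "x \<in> ?T"
      then have "x \<in> S" using T(2) by auto
      then show "?w x \<odot>\<^bsub>M\<^esub> \<phi> x = u x \<odot>\<^bsub>M\<^esub> \<phi> x \<oplus>\<^bsub>M\<^esub> v x \<odot>\<^bsub>M\<^esub> \<phi> x"
        using u v \<phi> by (auto simp: free_module_simps intro!: M.smult_l_distr)
    qed simp
    also have "\<dots> = (\<Oplus>\<^bsub>M\<^esub>x\<in>?T. u x \<odot>\<^bsub>M\<^esub> \<phi> x) \<oplus>\<^bsub>M\<^esub> (\<Oplus>\<^bsub>M\<^esub>x\<in>?T. v x \<odot>\<^bsub>M\<^esub> \<phi> x)"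
      using closed[OF u] closed[OF v] T(2) by (intro M.finsum_addf) auto
    also have "(\<Oplus>\<^bsub>M\<^esub>x\<in>?T. u x \<odot>\<^bsub>M\<^esub> \<phi> x) = free_lift A M \<phi> u"
      by (rule free_lift_superset[OF M u \<phi> T, symmetric]) auto
    also have "(\<Oplus>\<^bsub>M\<^esub>x\<in>?T. v x \<odot>\<^bsub>M\<^esub> \<phi> x) = free_lift A M \<phi> v"
      by (rule free_lift_superset[OF M v \<phi> T, symmetric]) auto
    finally show ?thesis .
  qed
  have 3: "free_lift A M \<phi> (a \<odot>\<^bsub>free_module A S\<^esub> u) = a \<odot>\<^bsub>M\<^esub> free_lift A M \<phi> u"
    if a: "a \<in> carrier A" and u: "u \<in> carrier (free_module A S)" for a u
  proof -
    let ?w = "a \<odot>\<^bsub>free_module A S\<^esub> u"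
    let ?T = "{x. u x \<noteq> \<zero>\<^bsub>A\<^esub>}"
    have w: "?w \<in> carrier (free_module A S)" using a u by (rule F.smult_closed)
    have "free_lift A M \<phi> ?w = (\<Oplus>\<^bsub>M\<^esub>x\<in>?T. ?w x \<odot>\<^bsub>M\<^esub> \<phi> x)"
      using a by (intro free_lift_superset[OF M w \<phi> supp[OF u]]) (auto simp: free_module_simps)
    also have "\<dots> = (\<Oplus>\<^bsub>M\<^esub>x\<in>?T. a \<odot>\<^bsub>M\<^esub> (u x \<odot>\<^bsub>M\<^esub> \<phi> x))"
    proof (rule M.finsum_cong')
      show "(\<lambda>x. a \<odot>\<^bsub>M\<^esub> (u x \<odot>\<^bsub>M\<^esub> \<phi> x)) \<in> ?T \<rightarrow> carrier M"
        using closed[OF u] supp(2)[OF u] a by auto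
      fix x assume "x \<in> ?T"
      then have "x \<in> S" using supp(2)[OF u] by auto
      then show "?w x \<odot>\<^bsub>M\<^esub> \<phi> x = a \<odot>\<^bsub>M\<^esub> (u x \<odot>\<^bsub>M\<^esub> \<phi> x)"
        using a u \<phi> by (auto simp: free_module_simps intro!: M.smult_assoc)
    qed simp
    also have "\<dots> = a \<odot>\<^bsub>M\<^esub> (\<Oplus>\<^bsub>M\<^esub>x\<in>?T. u x \<odot>\<^bsub>M\<^esub> \<phi> x)"
    proof (rule M.finsum_smult[OF a supp(1)[OF u]])
      show "(\<lambda>x. u x \<odot>\<^bsub>M\<^esub> \<phi> x) \<in> ?T \<rightarrow> carrier M" using closed[OF u] supp(2)[OF u] by blast
    qed
    also have "\<dots> = a \<odot>\<^bsub>M\<^esub> free_lift A M \<phi> u" by (simp add: free_lift_def)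
    finally show ?thesis .
  qed
  show ?thesis unfolding linear_map_def using 1 2 3 by auto
qed

lemma free_lift_basis:
  assumes M: "left_module A M" and \<phi>: "\<phi> \<in> S \<rightarrow> carrier M" and x: "x \<in> S"
  shows "free_lift A M \<phi> (free_basis A x) = \<phi> x"
proof -
  interpret M: left_module A M by fact
  have "free_lift A M \<phi> (free_basis A x) = (\<Oplus>\<^bsub>M\<^esub>y\<in>{x}. free_basis A x y \<odot>\<^bsub>M\<^esub> \<phi> y)"
    using x by (intro free_lift_superset[OF M free_basis_closed[OF _ x] \<phi>])
      (auto simp: free_basis_def intro: M.A.ring_axioms)
  also have "\<dots> = \<phi> x"
    using x \<phi> by (auto simp: free_basis_def Pi_iff)
  finally show ?thesis .
qed

lemma free_module_linear_eqI:
  assumes N: "left_module A N"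
    and f: "linear_map A (free_module A S) N f" and g: "linear_map A (free_module A S) N g"
    and basis: "\<And>x. x \<in> S \<Longrightarrow> f (free_basis A x) = g (free_basis A x)"
    and u: "u \<in> carrier (free_module A S)"
  shows "f u = g u"
proof -
  interpret N: left_module A N by fact
  have A: "ring A" by unfold_locales
  note F = left_module_free_module[OF A, of S]
  interpret F: left_module A "free_module A S" by (rule F)
  have "f u = g u" if "finite T" "T \<subseteq> S" "u \<in> carrier (free_module A S)" "{x. u x \<noteq> \<zero>\<^bsub>A\<^esub>} \<subseteq> T" for T u
    using that
  proof (induction T arbitrary: u rule: finite_induct)
    case empty
    then have "u = \<zero>\<^bsub>free_module A S\<^esub>" by (auto simp: free_module_simps)
    then show ?case using linear_map_zero[OF F N] f g by metis
  next
    case (insert t T)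
    let ?v = "\<lambda>x. if x = t then \<zero>\<^bsub>A\<^esub> else u x"
    let ?b = "u t \<odot>\<^bsub>free_module A S\<^esub> free_basis A t"
    have t: "t \<in> S" "u t \<in> carrier A" using insert.prems by (auto simp: free_module_simps)
    have "{x. ?v x \<noteq> \<zero>\<^bsub>A\<^esub>} \<subseteq> {x. u x \<noteq> \<zero>\<^bsub>A\<^esub>}" by auto
    moreover have "finite {x. u x \<noteq> \<zero>\<^bsub>A\<^esub>}" using insert.prems(2) by (simp add: free_module_simps)
    ultimately have "finite {x. ?v x \<noteq> \<zero>\<^bsub>A\<^esub>}" by (rule finite_subset)
    then have v: "?v \<in> carrier (free_module A S)"
      using insert.prems(2) by (simp add: free_module_simps)
    have b: "?b \<in> carrier (free_module A S)" using t free_basis_closed[OF A t(1)] by auto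
    have u: "u = ?v \<oplus>\<^bsub>free_module A S\<^esub> ?b"
      using insert.prems(2) by (auto simp: free_module_simps free_basis_def fun_eq_iff)
    have "f ?v = g ?v" using insert.prems by (intro insert.IH v) auto
    moreover have "f ?b = g ?b"
      using basis[OF t(1)] t linear_mapD(3)[OF f] linear_mapD(3)[OF g] free_basis_closed[OF A t(1)]
      by simp
    ultimately show ?case
      using linear_mapD(2)[OF f v b] linear_mapD(2)[OF g v b] u by metis
  qed
  from this[of "{x. u x \<noteq> \<zero>\<^bsub>A\<^esub>}" u] u show ?thesis by (auto simp: free_module_simps)
qed

lemma free_module_lift:
  fixes M :: "('a, 'm) module"
  assumes M: "left_module A M" and N: "left_module A N"
    and g: "linear_map A M N g" "g ` carrier M = carrier N"
    and f: "linear_map A (free_module A S) N f"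
  shows "\<exists>h. linear_map A (free_module A S) M h \<and>
    (\<forall>u\<in>carrier (free_module A S). g (h u) = f u)"
proof -
  interpret M: left_module A M by fact
  have A: "ring A" by unfold_locales
  have "\<exists>y\<in>carrier M. g y = f (free_basis A x)" if "x \<in> S" for x
    using linear_mapD(1)[OF f free_basis_closed[OF A that]] g(2) by (metis imageE)
  then obtain \<phi> where \<phi>: "\<And>x. x \<in> S \<Longrightarrow> \<phi> x \<in> carrier M \<and> g (\<phi> x) = f (free_basis A x)"
    by metis
  have \<phi>': "\<phi> \<in> S \<rightarrow> carrier M" using \<phi> by auto
  note lin = linear_map_free_lift[OF M \<phi>']
  have "g (free_lift A M \<phi> u) = f u" if "u \<in> carrier (free_module A S)" for u
    using free_module_linear_eqI[OF N linear_map_comp[OF lin g(1)] f _ that]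
      free_lift_basis[OF M \<phi>'] \<phi> by auto
  then show ?thesis using lin by blast
qed

lemma projective_free_module: "ring A \<Longrightarrow> projective A (free_module A S)"
  unfolding projective_def
  by (intro conjI allI impI left_module_free_module, assumption)
    (elim conjE, rule free_module_lift)

lemma projective_lift:
  fixes M :: "('a, 'm) module"
  assumes P: "projective A P" and M: "left_module A M" and N: "left_module A N"
    and g: "linear_map A M N g" "g ` carrier M = carrier N" and f: "linear_map A P N f"
  shows "\<exists>h. linear_map A P M h \<and> (\<forall>x\<in>carrier P. g (h x) = f x)"
proof -
  interpret M: left_module A M by fact
  have A: "ring A" by unfold_locales
  have P': "left_module A P" using P by (simp add: projective_def)
  interpret P: left_module A P by fact
  let ?F = "free_module A (carrier P)" and ?\<pi> = "free_lift A P (\<lambda>x. x)"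
  have \<pi>: "linear_map A ?F P ?\<pi>" by (rule linear_map_free_lift[OF P']) auto
  have "x \<in> ?\<pi> ` carrier ?F" if "x \<in> carrier P" for x
    using free_lift_basis[OF P' _ that, of "\<lambda>x. x"] free_basis_closed[OF A that]
    by (metis (lifting) Pi_I' image_eqI)
  then have \<pi>_surj: "?\<pi> ` carrier ?F = carrier P" using linear_mapD(1)[OF \<pi>] by auto
  have "linear_map A P P (\<lambda>x. x)" by (auto simp: linear_map_def)
  then obtain s where s: "linear_map A P ?F s" "\<And>x. x \<in> carrier P \<Longrightarrow> ?\<pi> (s x) = x"
    using P left_module_free_module[OF A] P' \<pi> \<pi>_surj unfolding projective_def by metis
  obtain h where h: "linear_map A ?F M h" "\<And>u. u \<in> carrier ?F \<Longrightarrow> g (h u) = f (?\<pi> u)"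
    using free_module_lift[OF M N g linear_map_comp[OF \<pi> f]] by blast
  show ?thesis
  proof (intro exI[of _ "\<lambda>x. h (s x)"] conjI ballI)
    show "linear_map A P M (\<lambda>x. h (s x))" by (rule linear_map_comp[OF s(1) h(1)])
    show "g (h (s x)) = f x" if "x \<in> carrier P" for x
      using h(2)[OF linear_mapD(1)[OF s(1) that]] s(2)[OF that] by simp
  qed
qed

text \<open>The resolution by free modules has its bases in the following type.\<close>

datatype ('a, 'm) syzygy = Generator 'm | Relation "(('a, 'm) syzygy \<times> 'a) list"

fun generator_of :: "('a, 'm) syzygy \<Rightarrow> 'm" where
  "generator_of (Generator x) = x"
| "generator_of (Relation l) = undefined"

fun relation_of :: "('a, 'c) ring_scheme \<Rightarrow> ('a, 'm) syzygy \<Rightarrow> ('a, 'm) syzygy \<Rightarrow> 'a" where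
  "relation_of A (Relation l) x = (case map_of l x of None \<Rightarrow> \<zero>\<^bsub>A\<^esub> | Some a \<Rightarrow> a)"
| "relation_of A (Generator y) x = \<zero>\<^bsub>A\<^esub>"

lemma relation_of_surj:
  assumes "finite {x. u x \<noteq> \<zero>\<^bsub>A\<^esub>}"
  shows "\<exists>t. relation_of A t = u"
proof -
  obtain l where l: "set l = {x. u x \<noteq> \<zero>\<^bsub>A\<^esub>}" using finite_list[OF assms] by blast
  have "relation_of A (Relation (map (\<lambda>x. (x, u x)) l)) = u"
    using l by (auto simp: fun_eq_iff map_of_map_restrict restrict_map_def)
  then show ?thesis by blast
qed

text \<open>The basis in degree \<open>n\<close>, and the set of cycles in the free module on it.\<close>

primrec syzygies ::
  "('a, 'c) ring_scheme \<Rightarrow> ('a, 'm) module \<Rightarrow> nat \<Rightarrow>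
    ('a, 'm) syzygy set \<times> (('a, 'm) syzygy \<Rightarrow> 'a) set"
  where
    "syzygies A M 0 =
      (let S = Generator ` carrier M
       in (S, {u \<in> carrier (free_module A S). free_lift A M generator_of u = \<zero>\<^bsub>M\<^esub>}))"
  | "syzygies A M (Suc n) =
      (let S = {t. relation_of A t \<in> snd (syzygies A M n)}
       in (S, {u \<in> carrier (free_module A S).
         free_lift A (free_module A (fst (syzygies A M n))) (relation_of A) u = (\<lambda>x. \<zero>\<^bsub>A\<^esub>)}))"

lemma projective_resolution_exists:
  fixes A :: "('a, 'c) ring_scheme" and M :: "('a, 'm) module"
  assumes M: "left_module A M"
  shows "\<exists>(P :: nat \<Rightarrow> ('a, ('a, 'm) syzygy \<Rightarrow> 'a) module) d p. projective_resolution A M P d p"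
proof -
  interpret M: left_module A M by fact
  have A: "ring A" by unfold_locales
  define S where "S n = fst (syzygies A M n)" for n
  define Z where "Z n = snd (syzygies A M n)" for n
  define P where "P n = free_module A (S n)" for n
  define d where "d n = free_lift A (P n) (relation_of A)" for n
  define p where "p = free_lift A M (generator_of :: ('a, 'm) syzygy \<Rightarrow> 'm)"
  have S0: "S 0 = Generator ` carrier M" by (simp add: S_def Let_def)
  have S_Suc: "S (Suc n) = {t. relation_of A t \<in> Z n}" for n
    by (simp add: S_def Z_def Let_def)
  have Z0: "Z 0 = {u \<in> carrier (P 0). p u = \<zero>\<^bsub>M\<^esub>}"
    by (simp add: Z_def P_def S_def p_def Let_def)
  have Z_Suc: "Z (Suc n) = {u \<in> carrier (P (Suc n)). d n u = \<zero>\<^bsub>P n\<^esub>}" for n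
    by (simp add: Z_def P_def S_def d_def Let_def free_module_simps)
  have P: "left_module A (P n)" for n unfolding P_def by (rule left_module_free_module[OF A])
  have Z_sub: "Z n \<subseteq> carrier (P n)" for n by (cases n) (auto simp: Z0 Z_Suc)
  have gen: "generator_of \<in> S 0 \<rightarrow> carrier M" by (auto simp: S0)
  have rel: "relation_of A \<in> S (Suc n) \<rightarrow> carrier (P n)" for n
    using Z_sub[of n] by (auto simp: S_Suc)
  have p: "linear_map A (P 0) M p"
    unfolding p_def P_def by (rule linear_map_free_lift[OF M gen])
  have d: "linear_map A (P (Suc n)) (P n) (d n)" for n
    unfolding d_def P_def[of "Suc n"] by (rule linear_map_free_lift[OF P rel])
  have p_surj: "p ` carrier (P 0) = carrier M"
  proof
    show "p ` carrier (P 0) \<subseteq> carrier M" using linear_mapD(1)[OF p] by auto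
    show "carrier M \<subseteq> p ` carrier (P 0)"
    proof
      fix x assume "x \<in> carrier M"
      then have x: "Generator x \<in> S 0" by (simp add: S0)
      show "x \<in> p ` carrier (P 0)"
        using free_lift_basis[OF M gen x] free_basis_closed[OF A x]
        by (metis P_def p_def generator_of.simps(1) image_eqI)
    qed
  qed
  have zero: "f (d n v) = \<zero>\<^bsub>L\<^esub>"
    if L: "left_module A L" and f: "linear_map A (P n) L f" "\<And>u. u \<in> Z n \<Longrightarrow> f u = \<zero>\<^bsub>L\<^esub>"
      and v: "v \<in> carrier (P (Suc n))" for L :: "('a, 'l) module" and f n v
  proof -
    interpret L: left_module A L by (rule L)
    have 0: "linear_map A (P (Suc n)) L (\<lambda>_. \<zero>\<^bsub>L\<^esub>)"
      by (auto simp: linear_map_def L.smult_r_null)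
    show ?thesis
    proof (rule free_module_linear_eqI[OF L linear_map_comp[OF d f(1), unfolded P_def[of "Suc n"]]
          0[unfolded P_def] _ v[unfolded P_def]])
      fix t assume t: "t \<in> S (Suc n)"
      then have "relation_of A t \<in> Z n" by (simp add: S_Suc)
      then show "f (d n (free_basis A t)) = \<zero>\<^bsub>L\<^esub>"
        using free_lift_basis[OF P rel t] f(2) by (simp add: d_def)
    qed
  qed
  have d_image: "d n ` carrier (P (Suc n)) = Z n" for n
  proof
    show "d n ` carrier (P (Suc n)) \<subseteq> Z n"
    proof (cases n)
      case 0
      then show ?thesis
        using zero[OF M p] linear_mapD(1)[OF d[of 0]] by (auto simp: Z0)
    next
      case (Suc k)
      then show ?thesis
        using zero[OF P d[of k]] linear_mapD(1)[OF d[of n]] by (auto simp: Z_Suc)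
    qed
    show "Z n \<subseteq> d n ` carrier (P (Suc n))"
    proof
      fix u assume u: "u \<in> Z n"
      then have "finite {x. u x \<noteq> \<zero>\<^bsub>A\<^esub>}"
        using Z_sub[of n] by (auto simp: P_def free_module_simps)
      then obtain t where t: "relation_of A t = u" using relation_of_surj by blast
      then have t': "t \<in> S (Suc n)" using u by (simp add: S_Suc)
      show "u \<in> d n ` carrier (P (Suc n))"
        using free_lift_basis[OF P rel t'] free_basis_closed[OF A t'] t
        by (metis P_def d_def image_eqI)
    qed
  qed
  have "projective_resolution A M P d p"
    unfolding projective_resolution_def
    using M projective_free_module[OF A] p d p_surj d_image Z0 Z_Suc by (auto simp: P_def)
  then show ?thesis by blast
qed

end

theory Submission
  imports Defs
begin

text \<open>
  The element \<open>u = \<delta>\<^sub>e \<otimes> e\<close> is a central idempotent of \<open>D = D(G)\<close>, and the factor \<open>Du\<close> of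
  \<open>D = Du \<times> D(1 - u)\<close> is the group algebra: the projection is \<open>\<pi> (\<delta>\<^sub>a \<otimes> b) = \<delta>\<^sub>a\<^sub>,\<^sub>e b\<close>, and it has the
  section \<open>\<sigma> b = \<epsilon> \<otimes> b\<close> (lemma \<open>central_corner_double\<close>). The counit of \<open>D\<close> is the counit of \<open>K[G]\<close>
  after \<open>\<pi>\<close>, so the trivial \<open>D\<close>-module lives entirely on this factor, and only the summand \<open>W\<^sub>e = uW\<close> of
  \<open>W\<close> can contribute to Ext.

  To turn this into a proof, a projective \<open>K[G]\<close>-resolution \<open>Q\<close> of \<open>K\<close> is inflated along \<open>\<pi>\<close> to a complex of
  \<open>D\<close>-modules. For a \<open>K[G]\<close>-module \<open>N\<close> and a \<open>D\<close>-module \<open>M\<close>, the \<open>D\<close>-linear maps from the inflation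
  of \<open>N\<close> to \<open>M\<close> are exactly the \<open>K[G]\<close>-linear maps from \<open>N\<close> to \<open>M\<^sub>e\<close> (lemma \<open>linear_map_inflation_iff\<close>).
  This adjunction is used twice. Since \<open>M \<mapsto> M\<^sub>e\<close> preserves surjections, it shows that inflation preserves
  projectivity, so the inflation of \<open>Q\<close> is a projective resolution of the trivial \<open>D\<close>-module. And it
  identifies the cochain complex of this resolution with coefficients in \<open>W\<close> with the one that computes
  \<open>H\<^sup>m(G, W\<^sub>e)\<close> (lemma \<open>Ext_inflation\<close>).

  The resolution \<open>P\<close> is unrelated to \<open>Q\<close>, so it remains to know that Ext does not depend on the resolution
  (lemma \<open>Ext_independent_of_resolution\<close>). This is the comparison theorem: chain maps between two
  projective resolutions of the same module exist, and they are unique up to homotopy.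
\<close>

section \<open>Linear maps and submodules\<close>

text \<open>
  A subset closed under addition and scalars is closed under negation because it is closed under the
  scalar \<open>-1\<close>.
\<close>

lemma left_module_submodule:
  assumes M: "left_module A M" and S: "S \<subseteq> carrier M" "\<zero>\<^bsub>M\<^esub> \<in> S"
    and add: "\<And>x y. x \<in> S \<Longrightarrow> y \<in> S \<Longrightarrow> x \<oplus>\<^bsub>M\<^esub> y \<in> S"
    and smult: "\<And>a x. a \<in> carrier A \<Longrightarrow> x \<in> S \<Longrightarrow> a \<odot>\<^bsub>M\<^esub> x \<in> S"
  shows "left_module A (M\<lparr>carrier := S\<rparr>)"
proof -
  interpret M: left_module A M by fact
  have mem: "x \<in> carrier M" if "x \<in> S" for x using that S by blast
  have neg: "\<exists>y\<in>S. y \<oplus>\<^bsub>M\<^esub> x = \<zero>\<^bsub>M\<^esub>" if "x \<in> S" for x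
  proof (rule bexI)
    have "(\<ominus>\<^bsub>A\<^esub> \<one>\<^bsub>A\<^esub>) \<odot>\<^bsub>M\<^esub> x \<oplus>\<^bsub>M\<^esub> x = (\<ominus>\<^bsub>A\<^esub> \<one>\<^bsub>A\<^esub> \<oplus>\<^bsub>A\<^esub> \<one>\<^bsub>A\<^esub>) \<odot>\<^bsub>M\<^esub> x"
      using mem[OF that] by (simp add: M.smult_l_distr)
    then show "(\<ominus>\<^bsub>A\<^esub> \<one>\<^bsub>A\<^esub>) \<odot>\<^bsub>M\<^esub> x \<oplus>\<^bsub>M\<^esub> x = \<zero>\<^bsub>M\<^esub>"
      using mem[OF that] by (simp add: M.A.l_neg M.smult_l_null)
  qed (use smult that in auto)
  have "left_module_axioms A (M\<lparr>carrier := S\<rparr>)"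
    by (unfold_locales)
      (auto simp: smult mem M.smult_l_distr M.smult_r_distr M.smult_assoc)
  moreover have "abelian_group (M\<lparr>carrier := S\<rparr>)"
    by (rule abelian_groupI) (auto simp: S add mem neg M.a_assoc intro: M.a_comm)
  ultimately show ?thesis
    by (simp add: left_module_def M.A.ring_axioms)
qed

lemma (in left_module) smult_minus:
  "a \<in> carrier A \<Longrightarrow> x \<in> carrier M \<Longrightarrow> a \<odot>\<^bsub>M\<^esub> (\<ominus>\<^bsub>M\<^esub> x) = \<ominus>\<^bsub>M\<^esub> (a \<odot>\<^bsub>M\<^esub> x)"
  by (rule M.minus_equality[symmetric])
    (simp_all add: smult_r_distr[symmetric] M.l_neg smult_r_null)

lemma linear_map_minus:
  assumes N: "left_module A N" and f: "linear_map A M N f" and g: "linear_map A M N g"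
  shows "linear_map A M N (\<lambda>x. f x \<ominus>\<^bsub>N\<^esub> g x)"
proof -
  interpret N: left_module A N by fact
  note f = linear_mapD[OF f] and g = linear_mapD[OF g]
  show ?thesis
    unfolding linear_map_def
    using f(1) g(1)
    by (auto simp: f(2,3) g(2,3) N.M.minus_eq N.M.minus_add N.M.add.m_ac N.smult_r_distr N.smult_minus)
qed

lemma linear_map_diff:
  assumes M: "left_module A M" and N: "left_module A N" and f: "linear_map A M N f"
    and xy: "x \<in> carrier M" "y \<in> carrier M"
  shows "f (x \<ominus>\<^bsub>M\<^esub> y) = f x \<ominus>\<^bsub>N\<^esub> f y"
proof -
  interpret M: left_module A M by fact
  interpret N: left_module A N by fact
  have "f x = f ((x \<ominus>\<^bsub>M\<^esub> y) \<oplus>\<^bsub>M\<^esub> y)"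
    using xy by (simp add: M.M.minus_eq M.M.a_assoc M.M.l_neg)
  also have "\<dots> = f (x \<ominus>\<^bsub>M\<^esub> y) \<oplus>\<^bsub>N\<^esub> f y"
    using xy by (simp add: linear_mapD(2)[OF f])
  finally show ?thesis
    using xy linear_mapD(1)[OF f] by (simp add: N.M.minus_eq N.M.a_assoc N.M.r_neg)
qed

lemma linear_map_id: "linear_map A M M (\<lambda>x. x)"
  by (auto simp: linear_map_def)

text \<open>
  The form of the lifting property that all inductive constructions below use: replacing \<open>L\<close> by the
  image of \<open>g\<close> turns \<open>g\<close> into a surjection, and in an exact complex that image is a kernel, so that the
  hypothesis on \<open>f\<close> becomes a composite being zero.
\<close>

lemma projective_lift_image:
  fixes N :: "('a, 'x) module" and L :: "('a, 'y) module"
  assumes P: "projective A P" and N: "left_module A N" and L: "left_module A L"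
    and g: "linear_map A N L g" and f: "linear_map A P L f"
    and image: "f ` carrier P \<subseteq> g ` carrier N"
  shows "\<exists>h. linear_map A P N h \<and> (\<forall>x\<in>carrier P. g (h x) = f x)"
proof -
  interpret N: left_module A N by fact
  let ?I = "L\<lparr>carrier := g ` carrier N\<rparr>"
  have "left_module A ?I"
  proof (rule left_module_submodule[OF L])
    show "g ` carrier N \<subseteq> carrier L" using linear_mapD(1)[OF g] by blast
    show "\<zero>\<^bsub>L\<^esub> \<in> g ` carrier N"
      by (rule image_eqI[of _ _ "\<zero>\<^bsub>N\<^esub>"]) (simp_all add: linear_map_zero[OF N L g])
    show "x \<oplus>\<^bsub>L\<^esub> y \<in> g ` carrier N" if "x \<in> g ` carrier N" "y \<in> g ` carrier N" for x y
      using that by (auto simp flip: linear_mapD(2)[OF g])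
    show "a \<odot>\<^bsub>L\<^esub> x \<in> g ` carrier N" if "a \<in> carrier A" "x \<in> g ` carrier N" for a x
      using that by (auto simp flip: linear_mapD(3)[OF g])
  qed
  moreover have "linear_map A N ?I g" "linear_map A P ?I f"
    using g f image by (auto simp: linear_map_def)
  ultimately show ?thesis
    using P N by (intro projective_lift[of A P N ?I]) auto
qed

section \<open>Comparison of projective resolutions\<close>

definition chain_map ::
  "('a, 'c) ring_scheme \<Rightarrow> (nat \<Rightarrow> ('a, 'p) module) \<Rightarrow> (nat \<Rightarrow> 'p \<Rightarrow> 'p) \<Rightarrow>
    (nat \<Rightarrow> ('a, 'q) module) \<Rightarrow> (nat \<Rightarrow> 'q \<Rightarrow> 'q) \<Rightarrow> (nat \<Rightarrow> 'p \<Rightarrow> 'q) \<Rightarrow> bool"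
  where "chain_map A P d Q e \<phi> \<longleftrightarrow>
    (\<forall>n. linear_map A (P n) (Q n) (\<phi> n)) \<and>
    (\<forall>n. \<forall>x\<in>carrier (P (Suc n)). e n (\<phi> (Suc n) x) = \<phi> n (d n x))"

lemma projective_resolutionD:
  assumes "projective_resolution A M P d p"
  shows "left_module A M" "projective A (P n)" "left_module A (P n)"
    and "linear_map A (P 0) M p" "linear_map A (P (Suc n)) (P n) (d n)"
    and "p ` carrier (P 0) = carrier M"
    and "d 0 ` carrier (P (Suc 0)) = {x \<in> carrier (P 0). p x = \<zero>\<^bsub>M\<^esub>}"
    and "d (Suc n) ` carrier (P (Suc (Suc n))) = {x \<in> carrier (P (Suc n)). d n x = \<zero>\<^bsub>P n\<^esub>}"
  using assms by (auto simp: projective_resolution_def projective_def)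

lemma projective_resolution_differential:
  assumes "projective_resolution A M P d p"
  shows "x \<in> carrier (P (Suc 0)) \<Longrightarrow> p (d 0 x) = \<zero>\<^bsub>M\<^esub>"
    and "y \<in> carrier (P (Suc (Suc n))) \<Longrightarrow> d n (d (Suc n) y) = \<zero>\<^bsub>P n\<^esub>"
  using projective_resolutionD(7,8)[OF assms] by blast+

text \<open>
  Each \<open>\<phi> (n + 1)\<close> is a lift of \<open>\<phi> n \<circ> d n\<close> along \<open>e n\<close>. To be liftable, \<open>\<phi> n\<close> has to send boundaries
  to boundaries; this is the invariant that is carried through the recursion, and it propagates
  because \<open>e n \<circ> \<phi> (n + 1) \<circ> d (n + 1) = \<phi> n \<circ> d n \<circ> d (n + 1) = 0\<close> and \<open>Q\<close> is exact.
\<close>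

lemma chain_map_exists:
  fixes P :: "nat \<Rightarrow> ('a, 'p) module" and Q :: "nat \<Rightarrow> ('a, 'q) module"
  assumes P: "projective_resolution A M P d p" and Q: "projective_resolution A M Q e q"
  shows "\<exists>\<phi>. chain_map A P d Q e \<phi> \<and> (\<forall>x\<in>carrier (P 0). q (\<phi> 0 x) = p x)"
proof -
  note P' = projective_resolutionD[OF P] and Q' = projective_resolutionD[OF Q]
  note dP = projective_resolution_differential[OF P]
  have "p ` carrier (P 0) \<subseteq> q ` carrier (Q 0)" using P'(6) Q'(6) by simp
  then obtain \<phi>0 where \<phi>0: "linear_map A (P 0) (Q 0) \<phi>0" "\<And>x. x \<in> carrier (P 0) \<Longrightarrow> q (\<phi>0 x) = p x"
    using projective_lift_image[OF P'(2) Q'(3) P'(1) Q'(4) P'(4)] by blast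
  \<comment> \<open>The clause for \<open>n = 0\<close> pins the start of the sequence that dependent choice returns.\<close>
  define I where "I n f \<longleftrightarrow> linear_map A (P n) (Q n) f \<and> (n = 0 \<longrightarrow> f = \<phi>0) \<and>
    (\<forall>x\<in>carrier (P (Suc n)). f (d n x) \<in> e n ` carrier (Q (Suc n)))" for n f
  have "I 0 \<phi>0"
    using \<phi>0 dP(1) linear_mapD(1)[OF \<phi>0(1)] linear_mapD(1)[OF P'(5)] by (auto simp: I_def Q'(7))
  moreover have "\<exists>g. I (Suc n) g \<and> (\<forall>x\<in>carrier (P (Suc n)). e n (g x) = f (d n x))"
    if f: "I n f" for n f
  proof -
    have lin: "linear_map A (P n) (Q n) f" using f by (simp add: I_def)
    have "(\<lambda>x. f (d n x)) ` carrier (P (Suc n)) \<subseteq> e n ` carrier (Q (Suc n))"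
      using f by (auto simp: I_def)
    then obtain g where g: "linear_map A (P (Suc n)) (Q (Suc n)) g"
      "\<And>x. x \<in> carrier (P (Suc n)) \<Longrightarrow> e n (g x) = f (d n x)"
      using projective_lift_image[OF P'(2) Q'(3) Q'(3) Q'(5) linear_map_comp[OF P'(5) lin]] by blast
    have "e n (g (d (Suc n) x)) = \<zero>\<^bsub>Q n\<^esub>" if x: "x \<in> carrier (P (Suc (Suc n)))" for x
      using g(2)[OF linear_mapD(1)[OF P'(5) x]] dP(2)[OF x] linear_map_zero[OF P'(3) Q'(3) lin]
      by simp
    then have "I (Suc n) g"
      using g(1) linear_mapD(1)[OF P'(5)] linear_mapD(1)[OF g(1)] by (simp add: I_def Q'(8))
    then show ?thesis using g(2) by blast
  qed
  ultimately obtain \<phi> where \<phi>: "\<And>n. I n (\<phi> n)"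
    "\<And>n. \<forall>x\<in>carrier (P (Suc n)). e n (\<phi> (Suc n) x) = \<phi> n (d n x)"
    using dependent_nat_choice[of I "\<lambda>n f g. \<forall>x\<in>carrier (P (Suc n)). e n (g x) = f (d n x)"]
    by metis
  have "\<phi> 0 = \<phi>0" using \<phi>(1)[of 0] by (simp add: I_def)
  then show ?thesis
    using \<phi> \<phi>0(2) by (intro exI[of _ \<phi>]) (auto simp: chain_map_def I_def)
qed

text \<open>
  Each \<open>s (n + 1)\<close> is a lift of \<open>\<theta> (n + 1) - s n \<circ> d n\<close> along \<open>e (n + 1)\<close>. This difference consists of
  cycles as soon as \<open>e n \<circ> s n\<close> agrees with \<open>\<theta> n\<close> on boundaries, which is the invariant of the
  recursion; stated in this form it makes degree \<open>0\<close> no exception.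
\<close>

lemma null_homotopy_exists:
  fixes P :: "nat \<Rightarrow> ('a, 'p) module" and Q :: "nat \<Rightarrow> ('a, 'q) module"
  assumes P: "projective_resolution A M P d p" and Q: "projective_resolution A M Q e q"
    and \<theta>: "chain_map A P d Q e \<theta>" and zero: "\<And>x. x \<in> carrier (P 0) \<Longrightarrow> q (\<theta> 0 x) = \<zero>\<^bsub>M\<^esub>"
  shows "\<exists>s. (\<forall>n. linear_map A (P n) (Q (Suc n)) (s n)) \<and>
    (\<forall>x\<in>carrier (P 0). \<theta> 0 x = e 0 (s 0 x)) \<and>
    (\<forall>n. \<forall>x\<in>carrier (P (Suc n)). \<theta> (Suc n) x = e (Suc n) (s (Suc n) x) \<oplus>\<^bsub>Q (Suc n)\<^esub> s n (d n x))"
proof -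
  note P' = projective_resolutionD[OF P] and Q' = projective_resolutionD[OF Q]
  note dP = projective_resolution_differential[OF P]
  have \<theta>_lin: "linear_map A (P n) (Q n) (\<theta> n)" for n using \<theta> by (simp add: chain_map_def)
  have \<theta>_comm: "e n (\<theta> (Suc n) x) = \<theta> n (d n x)" if "x \<in> carrier (P (Suc n))" for n x
    using \<theta> that by (simp add: chain_map_def)
  have "\<theta> 0 ` carrier (P 0) \<subseteq> e 0 ` carrier (Q (Suc 0))"
    using zero linear_mapD(1)[OF \<theta>_lin] by (auto simp: Q'(7))
  then obtain s0 where s0: "linear_map A (P 0) (Q (Suc 0)) s0"
    "\<And>x. x \<in> carrier (P 0) \<Longrightarrow> e 0 (s0 x) = \<theta> 0 x"
    using projective_lift_image[OF P'(2) Q'(3) Q'(3) Q'(5) \<theta>_lin] by blast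
  \<comment> \<open>The clause for \<open>n = 0\<close> pins the start of the sequence that dependent choice returns.\<close>
  define J where "J n s \<longleftrightarrow> linear_map A (P n) (Q (Suc n)) s \<and> (n = 0 \<longrightarrow> s = s0) \<and>
    (\<forall>x\<in>carrier (P (Suc n)). e n (s (d n x)) = \<theta> n (d n x))" for n s
  define R where "R n s t \<longleftrightarrow>
    (\<forall>x\<in>carrier (P (Suc n)). \<theta> (Suc n) x = e (Suc n) (t x) \<oplus>\<^bsub>Q (Suc n)\<^esub> s (d n x))" for n s t
  have "J 0 s0"
    using s0 linear_mapD(1)[OF P'(5)] by (simp add: J_def)
  moreover have "\<exists>t. J (Suc n) t \<and> R n s t" if s: "J n s" for n s
  proof -
    interpret Q0: left_module A "Q n" by (rule Q'(3))
    interpret Q1: left_module A "Q (Suc n)" by (rule Q'(3))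
    have s_lin: "linear_map A (P n) (Q (Suc n)) s" using s by (simp add: J_def)
    let ?r = "\<lambda>x. \<theta> (Suc n) x \<ominus>\<^bsub>Q (Suc n)\<^esub> s (d n x)"
    have r: "linear_map A (P (Suc n)) (Q (Suc n)) ?r"
      by (rule linear_map_minus[OF Q'(3) \<theta>_lin linear_map_comp[OF P'(5) s_lin]])
    have closed: "\<theta> (Suc n) x \<in> carrier (Q (Suc n))" "s (d n x) \<in> carrier (Q (Suc n))"
      "\<theta> n (d n x) \<in> carrier (Q n)"
      if "x \<in> carrier (P (Suc n))" for x
      using that linear_mapD(1)[OF \<theta>_lin] linear_mapD(1)[OF s_lin] linear_mapD(1)[OF P'(5)] by auto
    have "e n (?r x) = \<zero>\<^bsub>Q n\<^esub>" if x: "x \<in> carrier (P (Suc n))" for x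
    proof -
      have "\<theta> (Suc n) x = ?r x \<oplus>\<^bsub>Q (Suc n)\<^esub> s (d n x)"
        using closed[OF x] by (simp add: Q1.M.minus_eq Q1.M.a_assoc Q1.M.l_neg)
      then have "\<theta> n (d n x) = e n (?r x \<oplus>\<^bsub>Q (Suc n)\<^esub> s (d n x))"
        using \<theta>_comm[OF x] by simp
      also have "\<dots> = e n (?r x) \<oplus>\<^bsub>Q n\<^esub> e n (s (d n x))"
        by (rule linear_mapD(2)[OF Q'(5) linear_mapD(1)[OF r x] closed(2)[OF x]])
      finally have "\<theta> n (d n x) = e n (?r x) \<oplus>\<^bsub>Q n\<^esub> \<theta> n (d n x)"
        using s x by (simp add: J_def)
      then show ?thesis
        using closed(3)[OF x] linear_mapD(1)[OF Q'(5) linear_mapD(1)[OF r x]]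
        by (metis Q0.M.add.r_cancel_one')
    qed
    then have "?r ` carrier (P (Suc n)) \<subseteq> e (Suc n) ` carrier (Q (Suc (Suc n)))"
      using linear_mapD(1)[OF r] by (auto simp: Q'(8))
    then obtain t where t: "linear_map A (P (Suc n)) (Q (Suc (Suc n))) t"
      "\<And>x. x \<in> carrier (P (Suc n)) \<Longrightarrow> e (Suc n) (t x) = ?r x"
      using projective_lift_image[OF P'(2) Q'(3) Q'(3) Q'(5) r] by blast
    have "R n s t"
      unfolding R_def using t(2) closed by (simp add: Q1.M.minus_eq Q1.M.a_assoc Q1.M.l_neg)
    moreover have "e (Suc n) (t (d (Suc n) x)) = \<theta> (Suc n) (d (Suc n) x)"
      if x: "x \<in> carrier (P (Suc (Suc n)))" for x
    proof -
      have dx: "d (Suc n) x \<in> carrier (P (Suc n))" using linear_mapD(1)[OF P'(5) x] .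
      show ?thesis
        using t(2)[OF dx] closed[OF dx] dP(2)[OF x] linear_map_zero[OF P'(3) Q'(3) s_lin]
        by (simp add: Q1.M.minus_eq)
    qed
    ultimately show ?thesis using t(1) by (auto simp: J_def)
  qed
  ultimately obtain s where s: "\<And>n. J n (s n)" "\<And>n. R n (s n) (s (Suc n))"
    using dependent_nat_choice[of J R] by metis
  have "s 0 = s0" using s(1)[of 0] by (simp add: J_def)
  then show ?thesis
    using s s0(2) by (intro exI[of _ s]) (auto simp: J_def R_def)
qed

section \<open>Quotients of abelian groups with operators\<close>

lemma abelian_subgroup_by_closure:
  assumes V: "abelian_group V" and B: "B \<subseteq> carrier V" "\<zero>\<^bsub>V\<^esub> \<in> B"
    and add: "\<And>x y. x \<in> B \<Longrightarrow> y \<in> B \<Longrightarrow> x \<oplus>\<^bsub>V\<^esub> y \<in> B"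
    and neg: "\<And>x. x \<in> B \<Longrightarrow> \<exists>y\<in>B. y \<oplus>\<^bsub>V\<^esub> x = \<zero>\<^bsub>V\<^esub>"
  shows "abelian_subgroup B V"
proof (rule abelian_subgroupI3[OF additive_subgroupI V])
  interpret V: abelian_group V by fact
  show "subgroup B (add_monoid V)"
  proof (rule V.add.subgroupI)
    show "\<ominus>\<^bsub>V\<^esub> x \<in> B" if "x \<in> B" for x
      using neg[OF that] that B(1) V.minus_equality by blast
  qed (use B add in auto)
qed

text \<open>
  An abelian group with operators and a stable subgroup. Additivity of the operators together with
  stability makes the action on cosets well defined.
\<close>

locale operator_subgroup = abelian_subgroup B V
  for K :: "('k, 'r) ring_scheme" and B :: "'v set" and V :: "('k, 'v) module" (structure) +
  assumes op_closed: "k \<in> carrier K \<Longrightarrow> v \<in> carrier V \<Longrightarrow> k \<odot> v \<in> carrier V"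
    and op_add: "k \<in> carrier K \<Longrightarrow> v \<in> carrier V \<Longrightarrow> w \<in> carrier V \<Longrightarrow>
      k \<odot> (v \<oplus> w) = k \<odot> v \<oplus> k \<odot> w"
    and op_subgroup: "k \<in> carrier K \<Longrightarrow> b \<in> B \<Longrightarrow> k \<odot> b \<in> B"
begin

lemma coset_eq_iff:
  assumes "v \<in> carrier V" "w \<in> carrier V"
  shows "B +> v = B +> w \<longleftrightarrow> v \<ominus> w \<in> B"
  using assms a_coset_add_inv1 a_coset_add_inv2 a_coset_join1 a_coset_join2 a_subset a_subgroup
  by (metis minus_closed minus_eq)

lemma coset_absorb:
  assumes "b \<in> B" "v \<in> carrier V"
  shows "B +> (b \<oplus> v) = B +> v"
  using assms by (subst coset_eq_iff) (auto simp: minus_eq a_assoc r_neg)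

text \<open>
  The operators on \<^const>\<open>quotient_module\<close>, and the map induced on cosets in lemma
  \<open>quotient_module_isomorphism\<close>, are unions over all representatives; when all representatives give the
  same set, the union is that set.
\<close>

lemma coset_bind:
  assumes v: "v \<in> carrier V" and g: "\<And>b. b \<in> B \<Longrightarrow> g (b \<oplus> v) = C"
  shows "(\<Union>x\<in>B +> v. g x) = C"
proof -
  have "B +> v = (\<lambda>b. b \<oplus> v) ` B" by (auto simp: a_r_coset_def')
  then have "(\<Union>x\<in>B +> v. g x) = (\<Union>b\<in>B. C)" using g by simp
  moreover have "B \<noteq> {}" using additive_subgroup.zero_closed[OF is_additive_subgroup] by blast
  ultimately show ?thesis by simp
qed

lemma quotient_module_simps:
  "carrier (quotient_module V B) = (\<lambda>v. B +> v) ` carrier V"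
  "v \<in> carrier V \<Longrightarrow> w \<in> carrier V \<Longrightarrow> (B +> v) \<oplus>\<^bsub>quotient_module V B\<^esub> (B +> w) = B +> (v \<oplus> w)"
  "k \<in> carrier K \<Longrightarrow> v \<in> carrier V \<Longrightarrow> k \<odot>\<^bsub>quotient_module V B\<^esub> (B +> v) = B +> (k \<odot> v)"
proof -
  show "carrier (quotient_module V B) = (\<lambda>v. B +> v) ` carrier V"
    by (auto simp: quotient_module_def A_RCOSETS_def')
  show "(B +> v) \<oplus>\<^bsub>quotient_module V B\<^esub> (B +> w) = B +> (v \<oplus> w)"
    if "v \<in> carrier V" "w \<in> carrier V"
    using that by (simp add: quotient_module_def a_rcos_sum)
  show "k \<odot>\<^bsub>quotient_module V B\<^esub> (B +> v) = B +> (k \<odot> v)"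
    if k: "k \<in> carrier K" and v: "v \<in> carrier V"
  proof -
    have "(\<Union>x\<in>B +> v. B +> (k \<odot> x)) = B +> (k \<odot> v)"
      using k v by (intro coset_bind) (simp_all add: op_add op_subgroup op_closed coset_absorb)
    then show ?thesis by (simp add: quotient_module_def)
  qed
qed

end

text \<open>
  The hypothesis \<open>B\<close> says that \<open>\<phi>\<close> induces a well-defined injective map of cosets, the hypothesis \<open>surj\<close>
  that every coset is hit.
\<close>

lemma quotient_module_isomorphism:
  assumes V: "operator_subgroup K B V" and V': "operator_subgroup K B' V'"
    and closed: "\<And>v. v \<in> carrier V \<Longrightarrow> \<phi> v \<in> carrier V'"
    and add: "\<And>v w. v \<in> carrier V \<Longrightarrow> w \<in> carrier V \<Longrightarrow> \<phi> (v \<oplus>\<^bsub>V\<^esub> w) = \<phi> v \<oplus>\<^bsub>V'\<^esub> \<phi> w"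
    and smult: "\<And>k v. k \<in> carrier K \<Longrightarrow> v \<in> carrier V \<Longrightarrow> \<phi> (k \<odot>\<^bsub>V\<^esub> v) = k \<odot>\<^bsub>V'\<^esub> \<phi> v"
    and B: "\<And>v. v \<in> carrier V \<Longrightarrow> \<phi> v \<in> B' \<longleftrightarrow> v \<in> B"
    and surj: "\<And>w. w \<in> carrier V' \<Longrightarrow> \<exists>v\<in>carrier V. \<exists>b\<in>B'. w = b \<oplus>\<^bsub>V'\<^esub> \<phi> v"
  shows "isomorphic_modules K (quotient_module V B) (quotient_module V' B')"
proof -
  interpret V: operator_subgroup K B V by fact
  interpret V': operator_subgroup K B' V' by fact
  define F where "F C = (\<Union>v\<in>C. B' +>\<^bsub>V'\<^esub> \<phi> v)" for C
  have F: "F (B +>\<^bsub>V\<^esub> v) = B' +>\<^bsub>V'\<^esub> \<phi> v" if v: "v \<in> carrier V" for v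
    unfolding F_def
  proof (rule V.coset_bind[OF v])
    show "B' +>\<^bsub>V'\<^esub> \<phi> (b \<oplus>\<^bsub>V\<^esub> v) = B' +>\<^bsub>V'\<^esub> \<phi> v" if "b \<in> B" for b
      using that v B[of b] by (simp add: add closed V'.coset_absorb)
  qed
  have \<phi>_minus: "\<phi> (v \<ominus>\<^bsub>V\<^esub> w) = \<phi> v \<ominus>\<^bsub>V'\<^esub> \<phi> w" if "v \<in> carrier V" "w \<in> carrier V" for v w
  proof -
    have "\<phi> (v \<ominus>\<^bsub>V\<^esub> w) \<oplus>\<^bsub>V'\<^esub> \<phi> w = \<phi> v"
      using that add[of "v \<ominus>\<^bsub>V\<^esub> w" w] by (simp add: V.minus_eq V.a_assoc V.l_neg)
    then show ?thesis
      using that closed[of "v \<ominus>\<^bsub>V\<^esub> w"] closed[of w]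
      by (simp add: V'.minus_eq V'.a_assoc V'.r_neg flip: \<open>_ = \<phi> v\<close>)
  qed
  have inj: "B +>\<^bsub>V\<^esub> v = B +>\<^bsub>V\<^esub> w \<longleftrightarrow> B' +>\<^bsub>V'\<^esub> \<phi> v = B' +>\<^bsub>V'\<^esub> \<phi> w"
    if "v \<in> carrier V" "w \<in> carrier V" for v w
    using that B[of "v \<ominus>\<^bsub>V\<^esub> w"] by (simp add: V.coset_eq_iff V'.coset_eq_iff closed \<phi>_minus)
  have surj': "\<exists>v\<in>carrier V. B' +>\<^bsub>V'\<^esub> w = B' +>\<^bsub>V'\<^esub> \<phi> v" if "w \<in> carrier V'" for w
    using surj[OF that] closed V'.coset_absorb by metis
  show ?thesis
    unfolding isomorphic_modules_def
  proof (intro exI[of _ F] conjI)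
    show "linear_map K (quotient_module V B) (quotient_module V' B') F"
      by (auto simp: linear_map_def V.quotient_module_simps V'.quotient_module_simps
          F closed add smult V.op_closed)
    show "bij_betw F (carrier (quotient_module V B)) (carrier (quotient_module V' B'))"
      unfolding bij_betw_def
    proof
      show "inj_on F (carrier (quotient_module V B))"
        by (auto simp: inj_on_def V.quotient_module_simps F inj)
      show "F ` carrier (quotient_module V B) = carrier (quotient_module V' B')"
      proof -
        have "F ` carrier (quotient_module V B) = (\<lambda>v. B' +>\<^bsub>V'\<^esub> \<phi> v) ` carrier V"
          by (simp add: V.quotient_module_simps image_image F)
        also have "\<dots> = (\<lambda>w. B' +>\<^bsub>V'\<^esub> w) ` carrier V'"
          using surj' closed by blast
        finally show ?thesis by (simp add: V'.quotient_module_simps)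
      qed
    qed
  qed
qed

section \<open>Ext does not depend on the resolution\<close>

lemma Hom_space_simps:
  "f \<in> carrier (Hom_space A M N) \<longleftrightarrow> f \<in> extensional (carrier M) \<and> linear_map A M N f"
  "\<zero>\<^bsub>Hom_space A M N\<^esub> = (\<lambda>x\<in>carrier M. \<zero>\<^bsub>N\<^esub>)"
  "f \<oplus>\<^bsub>Hom_space A M N\<^esub> g = (\<lambda>x\<in>carrier M. f x \<oplus>\<^bsub>N\<^esub> g x)"
  "k \<odot>\<^bsub>Hom_space A M N\<^esub> f = (\<lambda>x\<in>carrier M. (k \<odot>\<^bsub>A\<^esub> \<one>\<^bsub>A\<^esub>) \<odot>\<^bsub>N\<^esub> f x)"
  by (auto simp: Hom_space_def)

lemma linear_map_restrict:
  assumes M: "left_module A M"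
  shows "linear_map A M N (restrict f (carrier M)) \<longleftrightarrow> linear_map A M N f"
proof -
  interpret M: left_module A M by fact
  show ?thesis by (auto simp: linear_map_def Pi_iff)
qed

lemma linear_map_zero_map: "left_module A N \<Longrightarrow> linear_map A M N (\<lambda>x. \<zero>\<^bsub>N\<^esub>)"
proof -
  assume "left_module A N"
  then interpret N: left_module A N .
  show "linear_map A M N (\<lambda>x. \<zero>\<^bsub>N\<^esub>)" by (auto simp: linear_map_def N.smult_r_null)
qed

lemma linear_map_add:
  assumes N: "left_module A N" and f: "linear_map A M N f" and g: "linear_map A M N g"
  shows "linear_map A M N (\<lambda>x. f x \<oplus>\<^bsub>N\<^esub> g x)"
proof -
  interpret N: left_module A N by fact
  note f = linear_mapD[OF f] and g = linear_mapD[OF g]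
  show ?thesis
    unfolding linear_map_def
    using f(1) g(1)
    by (auto simp: f(2,3) g(2,3) N.M.add.m_ac N.smult_r_distr)
qed

lemma abelian_group_Hom_space:
  assumes M: "left_module A M" and N: "left_module A N"
  shows "abelian_group (Hom_space A M N)"
proof -
  interpret M: left_module A M by fact
  interpret N: left_module A N by fact
  show ?thesis
  proof (rule abelian_groupI)
    fix f assume f: "f \<in> carrier (Hom_space A M N)"
    then have lin: "linear_map A M N f" and ext: "f \<in> extensional (carrier M)"
      by (simp_all add: Hom_space_simps)
    note closed = linear_mapD(1)[OF lin]
    show "\<zero>\<^bsub>Hom_space A M N\<^esub> \<oplus>\<^bsub>Hom_space A M N\<^esub> f = f"
      using closed ext by (auto simp: Hom_space_simps extensional_def)
    let ?g = "\<lambda>x\<in>carrier M. \<zero>\<^bsub>N\<^esub> \<ominus>\<^bsub>N\<^esub> f x"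
    have "?g \<in> carrier (Hom_space A M N)"
      using linear_map_minus[OF N linear_map_zero_map[OF N] lin]
      by (simp add: Hom_space_simps linear_map_restrict[OF M])
    moreover have "?g \<oplus>\<^bsub>Hom_space A M N\<^esub> f = \<zero>\<^bsub>Hom_space A M N\<^esub>"
      using closed by (auto simp: Hom_space_simps N.M.minus_eq N.M.l_neg)
    ultimately show "\<exists>g\<in>carrier (Hom_space A M N). g \<oplus>\<^bsub>Hom_space A M N\<^esub> f = \<zero>\<^bsub>Hom_space A M N\<^esub>"
      by blast
  next
    fix f g assume "f \<in> carrier (Hom_space A M N)" "g \<in> carrier (Hom_space A M N)"
    then show "f \<oplus>\<^bsub>Hom_space A M N\<^esub> g = g \<oplus>\<^bsub>Hom_space A M N\<^esub> f"
      "f \<oplus>\<^bsub>Hom_space A M N\<^esub> g \<in> carrier (Hom_space A M N)"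
      using linear_mapD(1)[of A M N]
      by (auto simp: Hom_space_simps linear_map_restrict[OF M] intro!: restrict_ext N.M.a_comm
          linear_map_add[OF N])
    fix h assume "h \<in> carrier (Hom_space A M N)"
    with \<open>f \<in> _\<close> \<open>g \<in> _\<close>
    show "f \<oplus>\<^bsub>Hom_space A M N\<^esub> g \<oplus>\<^bsub>Hom_space A M N\<^esub> h = f \<oplus>\<^bsub>Hom_space A M N\<^esub> (g \<oplus>\<^bsub>Hom_space A M N\<^esub> h)"
      using linear_mapD(1)[of A M N]
      by (auto simp: Hom_space_simps intro!: restrict_ext N.M.a_assoc)
  qed (auto simp: Hom_space_simps linear_map_restrict[OF M] linear_map_zero_map[OF N])
qed

text \<open>
  Precomposition serves twice: with a differential it is the differential of the cochain complex, with
  a component of a chain map it is the induced map of cochains.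
\<close>

lemma pullback_Hom_space:
  assumes L: "left_module A L" and \<phi>: "linear_map A L M \<phi>"
  shows "f \<in> carrier (Hom_space A M N) \<Longrightarrow> compose (carrier L) f \<phi> \<in> carrier (Hom_space A L N)"
    and "compose (carrier L) (f \<oplus>\<^bsub>Hom_space A M N\<^esub> g) \<phi> =
      compose (carrier L) f \<phi> \<oplus>\<^bsub>Hom_space A L N\<^esub> compose (carrier L) g \<phi>"
    and "compose (carrier L) \<zero>\<^bsub>Hom_space A M N\<^esub> \<phi> = \<zero>\<^bsub>Hom_space A L N\<^esub>"
    and "compose (carrier L) (k \<odot>\<^bsub>Hom_space A M N\<^esub> f) \<phi> =
      k \<odot>\<^bsub>Hom_space A L N\<^esub> compose (carrier L) f \<phi>"
proof -
  interpret L: left_module A L by fact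
  show "compose (carrier L) f \<phi> \<in> carrier (Hom_space A L N)" if "f \<in> carrier (Hom_space A M N)"
    using that linear_map_comp[OF \<phi>, of N f]
    by (simp add: Hom_space_simps compose_def linear_map_restrict[OF L])
qed (use linear_mapD(1)[OF \<phi>] in \<open>auto simp: Hom_space_simps compose_def restrict_def fun_eq_iff\<close>)

text \<open>
  The part of the notion of a \<open>K\<close>-algebra on which the \<open>K\<close>-structure of \<open>Hom\<close> rests: multiplying a
  linear map by \<open>k.1\<close> gives a linear map because \<open>k.1\<close> is central.
\<close>

locale central_scalars = A?: ring A
  for K :: "('k, 'r) ring_scheme" and A :: "('k, 'a) module" (structure) +
  assumes scalar_closed: "k \<in> carrier K \<Longrightarrow> k \<odot> \<one> \<in> carrier A"
    and scalar_central: "k \<in> carrier K \<Longrightarrow> a \<in> carrier A \<Longrightarrow> (k \<odot> \<one>) \<otimes> a = a \<otimes> (k \<odot> \<one>)"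
begin

lemma Hom_space_smult:
  assumes M: "left_module A M" and N: "left_module A N" and k: "k \<in> carrier K"
    and f: "f \<in> carrier (Hom_space A M N)"
  shows "k \<odot>\<^bsub>Hom_space A M N\<^esub> f \<in> carrier (Hom_space A M N)"
    and "g \<in> carrier (Hom_space A M N) \<Longrightarrow> k \<odot>\<^bsub>Hom_space A M N\<^esub> (f \<oplus>\<^bsub>Hom_space A M N\<^esub> g) =
      k \<odot>\<^bsub>Hom_space A M N\<^esub> f \<oplus>\<^bsub>Hom_space A M N\<^esub> k \<odot>\<^bsub>Hom_space A M N\<^esub> g"
proof -
  interpret N: left_module A N by fact
  note k' = scalar_closed[OF k]
  have lin: "linear_map A M N f" using f by (simp add: Hom_space_simps)
  note f' = linear_mapD[OF lin]
  have "(k \<odot> \<one>) \<odot>\<^bsub>N\<^esub> (a \<odot>\<^bsub>N\<^esub> f x) = a \<odot>\<^bsub>N\<^esub> ((k \<odot> \<one>) \<odot>\<^bsub>N\<^esub> f x)"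
    if "a \<in> carrier A" "x \<in> carrier M" for a x
    using that k' f'(1) scalar_central[OF k] by (simp flip: N.smult_assoc)
  then have "linear_map A M N (\<lambda>x. (k \<odot> \<one>) \<odot>\<^bsub>N\<^esub> f x)"
    using k' f' by (simp add: linear_map_def N.smult_r_distr)
  then show "k \<odot>\<^bsub>Hom_space A M N\<^esub> f \<in> carrier (Hom_space A M N)"
    by (simp add: Hom_space_simps linear_map_restrict[OF M])
  assume "g \<in> carrier (Hom_space A M N)"
  then show "k \<odot>\<^bsub>Hom_space A M N\<^esub> (f \<oplus>\<^bsub>Hom_space A M N\<^esub> g) =
      k \<odot>\<^bsub>Hom_space A M N\<^esub> f \<oplus>\<^bsub>Hom_space A M N\<^esub> k \<odot>\<^bsub>Hom_space A M N\<^esub> g"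
    using k' f'(1) linear_mapD(1)[of A M N g]
    by (auto simp: Hom_space_simps N.smult_r_distr intro!: restrict_ext)
qed

lemma operator_subgroup_coboundaries:
  assumes P: "projective_resolution A M P d p" and W: "left_module A W"
  shows "operator_subgroup K (coboundaries A P d W m)
    ((Hom_space A (P m) W)\<lparr>carrier := cocycles A P d W m\<rparr>)"
proof -
  interpret W: left_module A W by fact
  note P' = projective_resolutionD[OF P]
  let ?H = "\<lambda>m. Hom_space A (P m) W"
  let ?Z = "(?H m)\<lparr>carrier := cocycles A P d W m\<rparr>"
  interpret H: abelian_group "?H n" for n by (rule abelian_group_Hom_space[OF P'(3) W])
  note d = linear_mapD(1)[OF P'(5)]
  have neg: "\<exists>g\<in>cocycles A P d W m. g \<oplus>\<^bsub>?H m\<^esub> f = \<zero>\<^bsub>?H m\<^esub>" if f: "f \<in> cocycles A P d W m" for f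
  proof -
    have f': "f \<in> carrier (?H m)" using f by (simp add: cocycles_def)
    obtain g where g: "g \<in> carrier (?H m)" "g \<oplus>\<^bsub>?H m\<^esub> f = \<zero>\<^bsub>?H m\<^esub>"
      using H.a_inv_closed[OF f'] H.l_neg[OF f'] by blast
    have "g (d m x) = \<zero>\<^bsub>W\<^esub>" if x: "x \<in> carrier (P (Suc m))" for x
      using fun_cong[OF g(2), of "d m x"] d[OF x] f x g(1) linear_mapD(1)[of A "P m" W g]
      by (simp add: cocycles_def Hom_space_simps)
    then show ?thesis using g by (auto simp: cocycles_def)
  qed
  have "abelian_group ?Z"
  proof (rule abelian_groupI)
    show "x \<oplus>\<^bsub>?Z\<^esub> y \<in> carrier ?Z" if "x \<in> carrier ?Z" "y \<in> carrier ?Z" for x y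
      using that H.a_closed[of x m y] d by (auto simp: cocycles_def Hom_space_simps(3))
    show "\<zero>\<^bsub>?Z\<^esub> \<in> carrier ?Z"
      using H.zero_closed[of m] d by (auto simp: cocycles_def Hom_space_simps(2))
    show "\<exists>y\<in>carrier ?Z. y \<oplus>\<^bsub>?Z\<^esub> x = \<zero>\<^bsub>?Z\<^esub>" if "x \<in> carrier ?Z" for x
      using neg that by simp
  qed (auto simp: cocycles_def H.a_assoc intro: H.a_comm)
  moreover have "coboundaries A P d W m \<subseteq> cocycles A P d W m \<and> \<zero>\<^bsub>?H m\<^esub> \<in> coboundaries A P d W m \<and>
    (\<forall>f\<in>coboundaries A P d W m. (\<forall>g\<in>coboundaries A P d W m. f \<oplus>\<^bsub>?H m\<^esub> g \<in> coboundaries A P d W m) \<and>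
      (\<exists>g\<in>coboundaries A P d W m. g \<oplus>\<^bsub>?H m\<^esub> f = \<zero>\<^bsub>?H m\<^esub>) \<and>
      (\<forall>k\<in>carrier K. k \<odot>\<^bsub>?H m\<^esub> f \<in> coboundaries A P d W m))"
  proof (cases m)
    case 0
    have "k \<odot>\<^bsub>?H 0\<^esub> \<zero>\<^bsub>?H 0\<^esub> = \<zero>\<^bsub>?H 0\<^esub>" if "k \<in> carrier K" for k
      using scalar_closed[OF that] by (auto simp: Hom_space_simps W.smult_r_null)
    then show ?thesis
      using 0 d H.zero_closed[of 0] by (auto simp: cocycles_def Hom_space_simps(2))
  next
    case (Suc n)
    note pullback = pullback_Hom_space[OF P'(3) P'(5), where N = W]
    let ?c = "\<lambda>g. compose (carrier (P (Suc n))) g (d n)"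
    have "?c g (d (Suc n) x) = \<zero>\<^bsub>W\<^esub>" if "g \<in> carrier (?H n)" "x \<in> carrier (P (Suc (Suc n)))" for g x
      using that d linear_map_zero[OF P'(3) W] projective_resolution_differential(2)[OF P]
      by (simp add: compose_def Hom_space_simps)
    then have "?c ` carrier (?H n) \<subseteq> cocycles A P d W (Suc n)"
      using pullback(1) by (auto simp: cocycles_def)
    moreover have "\<exists>h\<in>carrier (?H n). ?c h \<oplus>\<^bsub>?H (Suc n)\<^esub> ?c g = \<zero>\<^bsub>?H (Suc n)\<^esub>"
      if "g \<in> carrier (?H n)" for g
      using H.a_inv_closed[OF that] H.l_neg[OF that] pullback(2,3) by metis
    moreover have "\<zero>\<^bsub>?H (Suc n)\<^esub> \<in> ?c ` carrier (?H n)"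
      using pullback(3) H.zero_closed by (metis image_eqI)
    moreover have "?c g \<oplus>\<^bsub>?H (Suc n)\<^esub> ?c h \<in> ?c ` carrier (?H n)"
      if "g \<in> carrier (?H n)" "h \<in> carrier (?H n)" for g h
      using that pullback(2) H.a_closed by (metis image_eqI)
    moreover have "k \<odot>\<^bsub>?H (Suc n)\<^esub> ?c g \<in> ?c ` carrier (?H n)"
      if "k \<in> carrier K" "g \<in> carrier (?H n)" for k g
      using that pullback(4) Hom_space_smult(1)[OF P'(3) W] by (metis image_eqI)
    ultimately show ?thesis using Suc by simp
  qed
  moreover have "k \<odot>\<^bsub>?H m\<^esub> f \<in> cocycles A P d W m" if "k \<in> carrier K" "f \<in> cocycles A P d W m" for k f
    using that Hom_space_smult(1)[OF P'(3) W, of k f m] scalar_closed d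
    by (simp add: cocycles_def Hom_space_simps(4) W.smult_r_null)
  ultimately show ?thesis
    by (intro operator_subgroup.intro operator_subgroup_axioms.intro abelian_subgroup_by_closure)
      (auto simp: cocycles_def Hom_space_smult(2)[OF P'(3) W])
qed

end

lemma chain_map_comp:
  assumes P: "\<And>n. linear_map A (P (Suc n)) (P n) (d n)"
    and \<phi>: "chain_map A P d Q e \<phi>" and \<psi>: "chain_map A Q e R h \<psi>"
  shows "chain_map A P d R h (\<lambda>n x. \<psi> n (\<phi> n x))"
  using assms linear_map_comp[of A "P n" "Q n" "\<phi> n" "R n" "\<psi> n" for n]
    linear_mapD(1)[of A "P n" "Q n" "\<phi> n" for n]
  by (simp add: chain_map_def)

lemma pullback_cocycles:
  assumes P: "projective_resolution A M P d p" and \<phi>: "chain_map A P d Q e \<phi>"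
    and f: "f \<in> cocycles A Q e W m"
  shows "compose (carrier (P m)) f (\<phi> m) \<in> cocycles A P d W m"
proof -
  note P' = projective_resolutionD[OF P]
  have lin: "linear_map A (P n) (Q n) (\<phi> n)" for n using \<phi> by (simp add: chain_map_def)
  have "f (\<phi> m (d m x)) = \<zero>\<^bsub>W\<^esub>" if x: "x \<in> carrier (P (Suc m))" for x
  proof -
    have "\<phi> m (d m x) = e m (\<phi> (Suc m) x)" using \<phi> x by (simp add: chain_map_def)
    then show ?thesis using f linear_mapD(1)[OF lin x] by (simp add: cocycles_def)
  qed
  moreover have "compose (carrier (P m)) f (\<phi> m) \<in> carrier (Hom_space A (P m) W)"
    using f by (intro pullback_Hom_space(1)[OF P'(3) lin]) (simp add: cocycles_def)
  ultimately show ?thesis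
    using linear_mapD(1)[OF P'(5)] by (simp add: cocycles_def compose_eq)
qed

lemma pullback_coboundaries:
  assumes P: "projective_resolution A M P d p" and Q: "projective_resolution A N Q e q"
    and \<phi>: "chain_map A P d Q e \<phi>" and f: "f \<in> coboundaries A Q e W m"
  shows "compose (carrier (P m)) f (\<phi> m) \<in> coboundaries A P d W m"
proof -
  note P' = projective_resolutionD[OF P] and Q' = projective_resolutionD[OF Q]
  have lin: "linear_map A (P n) (Q n) (\<phi> n)" for n using \<phi> by (simp add: chain_map_def)
  show ?thesis
  proof (cases m)
    case 0
    then show ?thesis using f pullback_Hom_space(3)[OF P'(3) lin[of 0]] by simp
  next
    case (Suc n)
    then obtain g where g: "g \<in> carrier (Hom_space A (Q n) W)"
      and f: "f = compose (carrier (Q (Suc n))) g (e n)" using f by auto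
    have "compose (carrier (P (Suc n))) f (\<phi> (Suc n)) =
        compose (carrier (P (Suc n))) (compose (carrier (P n)) g (\<phi> n)) (d n)"
      using \<phi> linear_mapD(1)[OF lin] linear_mapD(1)[OF P'(5)]
      by (auto simp: f compose_def chain_map_def intro!: restrict_ext)
    then show ?thesis using Suc pullback_Hom_space(1)[OF P'(3) lin g] by simp
  qed
qed

text \<open>
  For a homotopy \<open>\<theta> = e s + s d\<close> and a cocycle \<open>f\<close> one has \<open>f \<theta> = f e s + f s d = (f s) d\<close>.
\<close>

lemma pullback_null_homotopic:
  fixes P :: "nat \<Rightarrow> ('a, 'p) module" and Q :: "nat \<Rightarrow> ('a, 'q) module"
    and A :: "('k, 'a) module"
  assumes P: "projective_resolution A M P d p" and Q: "projective_resolution A M Q e q"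
    and \<theta>: "chain_map A P d Q e \<theta>" and zero: "\<And>x. x \<in> carrier (P 0) \<Longrightarrow> q (\<theta> 0 x) = \<zero>\<^bsub>M\<^esub>"
    and W: "left_module A W" and f: "f \<in> cocycles A Q e W m"
  shows "compose (carrier (P m)) f (\<theta> m) \<in> coboundaries A P d W m"
proof -
  interpret W: left_module A W by fact
  note P' = projective_resolutionD[OF P] and Q' = projective_resolutionD[OF Q]
  obtain s where s: "\<And>n. linear_map A (P n) (Q (Suc n)) (s n)"
    and s0: "\<And>x. x \<in> carrier (P 0) \<Longrightarrow> \<theta> 0 x = e 0 (s 0 x)"
    and s1: "\<And>n x. x \<in> carrier (P (Suc n)) \<Longrightarrow>
      \<theta> (Suc n) x = e (Suc n) (s (Suc n) x) \<oplus>\<^bsub>Q (Suc n)\<^esub> s n (d n x)"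
    using null_homotopy_exists[OF P Q \<theta> zero] by blast
  have lin: "linear_map A (Q m) W f" and cocycle: "\<And>y. y \<in> carrier (Q (Suc m)) \<Longrightarrow> f (e m y) = \<zero>\<^bsub>W\<^esub>"
    using f by (simp_all add: cocycles_def Hom_space_simps)
  show ?thesis
  proof (cases m)
    case 0
    then show ?thesis
      using s0 cocycle linear_mapD(1)[OF s] by (auto simp: Hom_space_simps compose_def intro!: restrict_ext)
  next
    case (Suc n)
    have "f (\<theta> (Suc n) x) = f (s n (d n x))" if x: "x \<in> carrier (P (Suc n))" for x
    proof -
      have dx: "d n x \<in> carrier (P n)" by (rule linear_mapD(1)[OF P'(5) x])
      have "f (\<theta> (Suc n) x) = f (e (Suc n) (s (Suc n) x)) \<oplus>\<^bsub>W\<^esub> f (s n (d n x))"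
        using lin linear_mapD(1)[OF s] linear_mapD(1)[OF Q'(5)] x dx
        by (simp add: s1 Suc linear_mapD(2))
      then show ?thesis
        using cocycle linear_mapD(1)[OF s] linear_mapD(1)[OF lin] x dx by (simp add: Suc)
    qed
    then have "compose (carrier (P (Suc n))) f (\<theta> (Suc n)) =
        compose (carrier (P (Suc n))) (compose (carrier (P n)) f (s n)) (d n)"
      using linear_mapD(1)[OF P'(5)] by (auto simp: compose_def intro!: restrict_ext)
    moreover have "compose (carrier (P n)) f (s n) \<in> carrier (Hom_space A (P n) W)"
      using pullback_Hom_space(1)[OF P'(3) s, of f n W] f Suc by (simp add: cocycles_def)
    ultimately show ?thesis using Suc by simp
  qed
qed

text \<open>
  An endomorphism of a resolution that lies over the identity of \<open>M\<close> differs from the identity by a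
  chain map over zero, which is null homotopic.
\<close>

lemma pullback_endomorphism_cohomologous:
  fixes P :: "nat \<Rightarrow> ('a, 'p) module" and A :: "('k, 'a) module"
  assumes P: "projective_resolution A M P d p" and \<chi>: "chain_map A P d P d \<chi>"
    and over: "\<And>x. x \<in> carrier (P 0) \<Longrightarrow> p (\<chi> 0 x) = p x"
    and W: "left_module A W" and f: "f \<in> cocycles A P d W m"
  shows "\<exists>b\<in>coboundaries A P d W m. f = b \<oplus>\<^bsub>Hom_space A (P m) W\<^esub> compose (carrier (P m)) f (\<chi> m)"
proof -
  note P' = projective_resolutionD[OF P]
  interpret P: left_module A "P n" for n by (rule P'(3))
  interpret M: left_module A M by (rule P'(1))
  let ?\<theta> = "\<lambda>n x. x \<ominus>\<^bsub>P n\<^esub> \<chi> n x"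
  have lin: "linear_map A (P n) (P n) (\<chi> n)" for n using \<chi> by (simp add: chain_map_def)
  note closed = linear_mapD(1)[OF lin]
  have "chain_map A P d P d ?\<theta>"
    using linear_map_minus[OF P'(3) linear_map_id lin] closed linear_map_diff[OF P'(3,3,5)] \<chi>
    by (simp add: chain_map_def)
  moreover have "p (?\<theta> 0 x) = \<zero>\<^bsub>M\<^esub>" if "x \<in> carrier (P 0)" for x
    using that closed linear_map_diff[OF P'(3,1,4)] over linear_mapD(1)[OF P'(4)] by (simp add: M.M.minus_eq M.M.r_neg)
  ultimately have b: "compose (carrier (P m)) f (?\<theta> m) \<in> coboundaries A P d W m"
    by (rule pullback_null_homotopic[OF P P _ _ W f])
  have f': "linear_map A (P m) W f" "f \<in> extensional (carrier (P m))"
    using f by (simp_all add: cocycles_def Hom_space_simps)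
  have "f x = f (?\<theta> m x) \<oplus>\<^bsub>W\<^esub> f (\<chi> m x)" if x: "x \<in> carrier (P m)" for x
    using x closed[OF x]
    by (simp add: P.M.minus_eq P.M.a_assoc P.M.l_neg flip: linear_mapD(2)[OF f'(1)])
  then have "f = compose (carrier (P m)) f (?\<theta> m) \<oplus>\<^bsub>Hom_space A (P m) W\<^esub> compose (carrier (P m)) f (\<chi> m)"
    using f'(2) by (auto simp: Hom_space_simps compose_def extensional_def fun_eq_iff)
  then show ?thesis using b by blast
qed

text \<open>
  The comparison theorem. Chain maps \<open>\<phi>\<close> and \<open>\<psi>\<close> in both directions induce maps of cochains whose two
  composites change a cocycle by a coboundary only. Hence pulling back along \<open>\<phi>\<close> both reflects
  coboundaries and is surjective up to coboundaries.
\<close>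

lemma (in central_scalars) Ext_independent_of_resolution:
  fixes P :: "nat \<Rightarrow> ('a, 'p) module" and Q :: "nat \<Rightarrow> ('a, 'q) module"
  assumes P: "projective_resolution A M P d p" and Q: "projective_resolution A M Q e q"
    and W: "left_module A W"
  shows "isomorphic_modules K (Ext A P d W m) (Ext A Q e W m)"
proof -
  note P' = projective_resolutionD[OF P] and Q' = projective_resolutionD[OF Q]
  obtain \<phi> where \<phi>: "chain_map A Q e P d \<phi>" "\<And>x. x \<in> carrier (Q 0) \<Longrightarrow> p (\<phi> 0 x) = q x"
    using chain_map_exists[OF Q P] by blast
  obtain \<psi> where \<psi>: "chain_map A P d Q e \<psi>" "\<And>x. x \<in> carrier (P 0) \<Longrightarrow> q (\<psi> 0 x) = p x"
    using chain_map_exists[OF P Q] by blast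
  have \<phi>_lin: "linear_map A (Q n) (P n) (\<phi> n)" and \<psi>_lin: "linear_map A (P n) (Q n) (\<psi> n)" for n
    using \<phi> \<psi> by (simp_all add: chain_map_def)
  let ?\<phi> = "\<lambda>f. compose (carrier (Q m)) f (\<phi> m)" and ?\<psi> = "\<lambda>f. compose (carrier (P m)) f (\<psi> m)"
  let ?ZP = "(Hom_space A (P m) W)\<lparr>carrier := cocycles A P d W m\<rparr>"
    and ?ZQ = "(Hom_space A (Q m) W)\<lparr>carrier := cocycles A Q e W m\<rparr>"
  note BP = operator_subgroup_coboundaries[OF P W, of m]
    and BQ = operator_subgroup_coboundaries[OF Q W, of m]
  interpret BP: operator_subgroup K "coboundaries A P d W m" ?ZP by (rule BP)
  have \<psi>\<phi>: "\<exists>b\<in>coboundaries A P d W m. f = b \<oplus>\<^bsub>?ZP\<^esub> ?\<psi> (?\<phi> f)" if f: "f \<in> cocycles A P d W m" for f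
  proof -
    have "?\<psi> (?\<phi> f) = compose (carrier (P m)) f (\<lambda>x. \<phi> m (\<psi> m x))"
      using linear_mapD(1)[OF \<psi>_lin] by (auto simp: compose_def intro!: restrict_ext)
    then show ?thesis
      using pullback_endomorphism_cohomologous[OF P chain_map_comp[OF P'(5) \<psi>(1) \<phi>(1)] _ W f]
        \<phi>(2) \<psi>(2) linear_mapD(1)[OF \<psi>_lin] by simp
  qed
  have \<phi>\<psi>: "\<exists>b\<in>coboundaries A Q e W m. f = b \<oplus>\<^bsub>?ZQ\<^esub> ?\<phi> (?\<psi> f)" if f: "f \<in> cocycles A Q e W m" for f
  proof -
    have "?\<phi> (?\<psi> f) = compose (carrier (Q m)) f (\<lambda>x. \<psi> m (\<phi> m x))"
      using linear_mapD(1)[OF \<phi>_lin] by (auto simp: compose_def intro!: restrict_ext)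
    then show ?thesis
      using pullback_endomorphism_cohomologous[OF Q chain_map_comp[OF Q'(5) \<phi>(1) \<psi>(1)] _ W f]
        \<phi>(2) \<psi>(2) linear_mapD(1)[OF \<phi>_lin] by simp
  qed
  show ?thesis
    unfolding Ext_def
  proof (rule quotient_module_isomorphism[where \<phi> = ?\<phi>, OF BP BQ])
    show "?\<phi> f \<in> coboundaries A Q e W m \<longleftrightarrow> f \<in> coboundaries A P d W m" if f: "f \<in> carrier ?ZP" for f
    proof
      assume "?\<phi> f \<in> coboundaries A Q e W m"
      then have "?\<psi> (?\<phi> f) \<in> coboundaries A P d W m" by (rule pullback_coboundaries[OF P Q \<psi>(1)])
      moreover obtain b where b: "b \<in> coboundaries A P d W m" "f = b \<oplus>\<^bsub>?ZP\<^esub> ?\<psi> (?\<phi> f)"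
        using \<psi>\<phi>[of f] f by auto
      ultimately show "f \<in> coboundaries A P d W m"
        by (subst b(2)) (rule additive_subgroup.a_closed[OF BP.is_additive_subgroup])
    qed (rule pullback_coboundaries[OF Q P \<phi>(1)])
    show "\<exists>f\<in>carrier ?ZP. \<exists>b\<in>coboundaries A Q e W m. g = b \<oplus>\<^bsub>?ZQ\<^esub> ?\<phi> f" if "g \<in> carrier ?ZQ" for g
      using that \<phi>\<psi>[of g] pullback_cocycles[OF P \<psi>(1), of g W m]
      by (intro bexI[of _ "?\<psi> g"]) auto
  qed (use pullback_cocycles[OF Q \<phi>(1)] in \<open>simp_all add: pullback_Hom_space(2,4)[OF Q'(3) \<phi>_lin]\<close>)
qed

section \<open>Restriction of scalars to a central corner\<close>

definition restrict_scalars :: "('b \<Rightarrow> 'a) \<Rightarrow> ('a, 'm) module \<Rightarrow> ('b, 'm) module"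
  where "restrict_scalars h M =
    \<lparr>carrier = carrier M,
     monoid.mult = monoid.mult M,
     one = \<one>\<^bsub>M\<^esub>,
     ring.zero = \<zero>\<^bsub>M\<^esub>,
     add = add M,
     smult = (\<lambda>b x. h b \<odot>\<^bsub>M\<^esub> x)\<rparr>"

lemma restrict_scalars_simps [simp]:
  "carrier (restrict_scalars h M) = carrier M"
  "\<zero>\<^bsub>restrict_scalars h M\<^esub> = \<zero>\<^bsub>M\<^esub>"
  "x \<oplus>\<^bsub>restrict_scalars h M\<^esub> y = x \<oplus>\<^bsub>M\<^esub> y"
  "b \<odot>\<^bsub>restrict_scalars h M\<^esub> x = h b \<odot>\<^bsub>M\<^esub> x"
  by (simp_all add: restrict_scalars_def)

lemma left_module_restrict_scalars:
  assumes "ring B" and h: "h \<in> ring_hom B A" and M: "left_module A M"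
  shows "left_module B (restrict_scalars h M)"
proof -
  interpret M: left_module A M by fact
  have "abelian_group (restrict_scalars h M)"
  proof (rule abelian_groupI)
    show "\<exists>y\<in>carrier (restrict_scalars h M). y \<oplus>\<^bsub>restrict_scalars h M\<^esub> x = \<zero>\<^bsub>restrict_scalars h M\<^esub>"
      if "x \<in> carrier (restrict_scalars h M)" for x
      using that M.M.l_neg[of x] M.M.a_inv_closed[of x] by auto
  qed (auto simp: M.M.a_assoc intro: M.M.a_comm)
  moreover have "left_module_axioms B (restrict_scalars h M)"
    by (unfold_locales)
      (use h in \<open>auto simp: ring_hom_closed[OF h] ring_hom_mult[OF h] ring_hom_add[OF h] ring_hom_one[OF h]
        M.smult_l_distr M.smult_r_distr M.smult_assoc\<close>)
  ultimately show ?thesis using \<open>ring B\<close> by (simp add: left_module_def)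
qed

text \<open>
  For a central idempotent \<open>u\<close> this is the direct summand \<open>uM\<close> of \<open>M\<close>.
\<close>

definition fixed_part :: "'a \<Rightarrow> ('a, 'm) module \<Rightarrow> ('a, 'm) module"
  where "fixed_part u M = M\<lparr>carrier := {x \<in> carrier M. u \<odot>\<^bsub>M\<^esub> x = x}\<rparr>"

lemma fixed_part_simps [simp]:
  "x \<in> carrier (fixed_part u M) \<longleftrightarrow> x \<in> carrier M \<and> u \<odot>\<^bsub>M\<^esub> x = x"
  "\<zero>\<^bsub>fixed_part u M\<^esub> = \<zero>\<^bsub>M\<^esub>"
  "x \<oplus>\<^bsub>fixed_part u M\<^esub> y = x \<oplus>\<^bsub>M\<^esub> y"
  "a \<odot>\<^bsub>fixed_part u M\<^esub> x = a \<odot>\<^bsub>M\<^esub> x"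
  by (simp_all add: fixed_part_def)

text \<open>
  The situation \<open>A = Au \<times> A(1 - u)\<close> for a central idempotent \<open>u\<close>, with the factor \<open>Au\<close> identified with a
  ring \<open>B\<close>: the map \<open>\<pi>\<close> is the projection to that factor, and \<open>\<sigma>\<close> is a unital section of \<open>\<pi>\<close>, in general
  different from the inclusion of \<open>Au\<close>, but agreeing with it after multiplication by \<open>u\<close>.
\<close>

locale central_corner = A: ring A + B: ring B
  for A :: "('a, 'c) ring_scheme" and B :: "('b, 'd) ring_scheme" +
  fixes \<pi> :: "'a \<Rightarrow> 'b" and \<sigma> :: "'b \<Rightarrow> 'a" and u :: 'a
  assumes \<pi>: "\<pi> \<in> ring_hom A B" and \<sigma>: "\<sigma> \<in> ring_hom B A"
    and \<pi>_\<sigma>: "b \<in> carrier B \<Longrightarrow> \<pi> (\<sigma> b) = b"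
    and u_closed: "u \<in> carrier A"
    and \<pi>_u: "\<pi> u = \<one>\<^bsub>B\<^esub>"
    and u_central: "a \<in> carrier A \<Longrightarrow> u \<otimes>\<^bsub>A\<^esub> a = a \<otimes>\<^bsub>A\<^esub> u"
    and \<sigma>_\<pi>: "a \<in> carrier A \<Longrightarrow> \<sigma> (\<pi> a) \<otimes>\<^bsub>A\<^esub> u = a \<otimes>\<^bsub>A\<^esub> u"
begin

lemma u_idempotent: "u \<otimes>\<^bsub>A\<^esub> u = u"
  using \<sigma>_\<pi>[OF u_closed] u_closed ring_hom_one[OF \<sigma>] by (simp add: \<pi>_u)

abbreviation corner :: "('a, 'm) module \<Rightarrow> ('b, 'm) module"
  where "corner M \<equiv> restrict_scalars \<sigma> (fixed_part u M)"

abbreviation inflation :: "('b, 'm) module \<Rightarrow> ('a, 'm) module"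
  where "inflation M \<equiv> restrict_scalars \<pi> M"

lemma left_module_corner:
  assumes M: "left_module A M"
  shows "left_module B (corner M)"
proof (rule left_module_restrict_scalars[OF B.ring_axioms \<sigma>])
  interpret M: left_module A M by fact
  have "u \<odot>\<^bsub>M\<^esub> (a \<odot>\<^bsub>M\<^esub> x) = a \<odot>\<^bsub>M\<^esub> (u \<odot>\<^bsub>M\<^esub> x)"
    if "a \<in> carrier A" "x \<in> carrier M" for a x
    using that u_closed u_central by (simp flip: M.smult_assoc)
  then show "left_module A (fixed_part u M)"
    unfolding fixed_part_def using u_closed
    by (intro left_module_submodule[OF M]) (auto simp: M.smult_r_distr M.smult_r_null)
qed

lemma left_module_inflation: "left_module B N \<Longrightarrow> left_module A (inflation N)"
  by (rule left_module_restrict_scalars[OF A.ring_axioms \<pi>])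

text \<open>
  The reason for the theorem: inflation along \<open>\<pi>\<close> is left adjoint to taking the corner, and the
  adjunction does not even change the underlying functions. The idempotent \<open>u\<close> acts as \<open>\<pi> u = 1\<close> on an
  inflated module, so every linear map out of it has values fixed by \<open>u\<close>; and on elements fixed
  by \<open>u\<close>, a scalar \<open>a\<close> acts like \<open>a u = \<sigma> (\<pi> a) u\<close>.
\<close>

lemma linear_map_inflation_iff:
  assumes N: "left_module B N" and M: "left_module A M"
  shows "linear_map A (inflation N) M f \<longleftrightarrow> linear_map B N (corner M) f"
proof
  interpret N: left_module B N by fact
  interpret M: left_module A M by fact
  assume f: "linear_map A (inflation N) M f"
  note f' = linear_mapD[OF f, simplified]
  have "u \<odot>\<^bsub>M\<^esub> f x = f x" if "x \<in> carrier N" for x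
    using f'(3)[OF u_closed that] that by (simp add: \<pi>_u)
  moreover have "f (b \<odot>\<^bsub>N\<^esub> x) = \<sigma> b \<odot>\<^bsub>M\<^esub> f x" if "b \<in> carrier B" "x \<in> carrier N" for b x
    using f'(3)[OF ring_hom_closed[OF \<sigma> that(1)] that(2)] that by (simp add: \<pi>_\<sigma>)
  ultimately show "linear_map B N (corner M) f"
    using f' by (auto simp: linear_map_def)
next
  interpret M: left_module A M by fact
  assume f: "linear_map B N (corner M) f"
  note f' = linear_mapD[OF f, simplified]
  have "f (\<pi> a \<odot>\<^bsub>N\<^esub> x) = a \<odot>\<^bsub>M\<^esub> f x" if a: "a \<in> carrier A" and x: "x \<in> carrier N" for a x
  proof -
    have fx: "f x \<in> carrier M" "u \<odot>\<^bsub>M\<^esub> f x = f x" using f'(1)[OF x] by auto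
    have \<sigma>\<pi>a: "\<sigma> (\<pi> a) \<in> carrier A"
      using a by (intro ring_hom_closed[OF \<sigma>] ring_hom_closed[OF \<pi>])
    have "f (\<pi> a \<odot>\<^bsub>N\<^esub> x) = \<sigma> (\<pi> a) \<odot>\<^bsub>M\<^esub> (u \<odot>\<^bsub>M\<^esub> f x)"
      using f'(3)[OF ring_hom_closed[OF \<pi> a] x] fx by simp
    also have "\<dots> = a \<odot>\<^bsub>M\<^esub> (u \<odot>\<^bsub>M\<^esub> f x)"
      using a fx(1) u_closed \<sigma>\<pi>a \<sigma>_\<pi>[OF a] by (simp flip: M.smult_assoc)
    finally show ?thesis using fx by simp
  qed
  then show "linear_map A (inflation N) M f"
    using f' by (auto simp: linear_map_def)
qed

lemma linear_map_corner:
  assumes "left_module A N" "linear_map A M N f"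
  shows "linear_map B (corner M) (corner N) f"
proof -
  note f = linear_mapD[OF assms(2)]
  have "u \<odot>\<^bsub>N\<^esub> f x = f x" if "x \<in> carrier M" "u \<odot>\<^bsub>M\<^esub> x = x" for x
    using f(3)[OF u_closed that(1)] that(2) by simp
  then show ?thesis
    using f ring_hom_closed[OF \<sigma>] by (auto simp: linear_map_def)
qed

text \<open>
  A left adjoint of a functor that preserves surjections preserves projectivity. Taking corners
  preserves surjections because any preimage of an element fixed by \<open>u\<close> can be multiplied by \<open>u\<close>.
\<close>

lemma projective_inflation:
  fixes N :: "('b, 'n) module"
  assumes N: "projective B N"
  shows "projective A (inflation N)"
proof -
  have N': "left_module B N" using N by (simp add: projective_def)
  have "\<exists>h. linear_map A (inflation N) M h \<and> (\<forall>x\<in>carrier N. g (h x) = f x)"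
    if M: "left_module A M" and L: "left_module A L" and g: "linear_map A M L g" "g ` carrier M = carrier L"
      and f: "linear_map A (inflation N) L f" for M :: "('a, 'n \<Rightarrow> 'a) module" and L :: "('a, 'n) module" and f g
  proof -
    interpret M: left_module A M by fact
    have "y \<in> g ` carrier (corner M)" if y: "y \<in> carrier (corner L)" for y
    proof -
      have "y \<in> g ` carrier M" using y g(2) by simp
      then obtain x where x: "x \<in> carrier M" "g x = y" by blast
      then have "g (u \<odot>\<^bsub>M\<^esub> x) = y" using linear_mapD(3)[OF g(1) u_closed] y by simp
      moreover have "u \<odot>\<^bsub>M\<^esub> x \<in> carrier (corner M)"
        using x(1) u_closed by (simp add: u_idempotent flip: M.smult_assoc)
      ultimately show ?thesis by blast
    qed
    moreover note g' = linear_map_corner[OF L g(1)]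
    ultimately have "g ` carrier (corner M) = carrier (corner L)"
      using linear_mapD(1)[OF g'] by blast
    then show ?thesis
      using projective_lift[OF N left_module_corner[OF M] left_module_corner[OF L] g']
        f linear_map_inflation_iff[OF N' M] linear_map_inflation_iff[OF N' L] by blast
  qed
  then show ?thesis
    unfolding projective_def restrict_scalars_simps
    using left_module_inflation[OF N'] by blast
qed

lemma linear_map_inflation: "linear_map B M N f \<Longrightarrow> linear_map A (inflation M) (inflation N) f"
  using ring_hom_closed[OF \<pi>] by (auto simp: linear_map_def)

text \<open>
  Exactness concerns the underlying sets alone, and inflation does not change these. The target \<open>N\<close> is
  \<open>M\<close> with an action that makes \<open>p\<close> linear over \<open>A\<close>.
\<close>

lemma projective_resolution_inflation:
  assumes P: "projective_resolution B M P d p"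
    and N: "left_module A N" "carrier N = carrier M" "\<zero>\<^bsub>N\<^esub> = \<zero>\<^bsub>M\<^esub>"
    and p: "linear_map A (inflation (P 0)) N p"
  shows "projective_resolution A N (\<lambda>n. inflation (P n)) d p"
  using P N p by (simp add: projective_resolution_def linear_map_inflation projective_inflation)

end

text \<open>
  The two cochain complexes consist of the same functions, so the cohomologies are equal and not just
  isomorphic. The hypothesis \<open>scalars\<close> makes the two actions of \<open>K\<close> coincide.
\<close>

lemma Ext_inflation:
  fixes A :: "('k, 'a) module" and B :: "('k, 'b) module"
  assumes "central_corner A B \<pi> \<sigma> u"
    and scalars: "\<And>k. \<sigma> (k \<odot>\<^bsub>B\<^esub> \<one>\<^bsub>B\<^esub>) = k \<odot>\<^bsub>A\<^esub> \<one>\<^bsub>A\<^esub>"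
    and P: "\<And>n. left_module B (P n)" and W: "left_module A W"
  shows "Ext A (\<lambda>n. restrict_scalars \<pi> (P n)) d W m =
    Ext B P d (restrict_scalars \<sigma> (fixed_part u W)) m"
proof -
  interpret central_corner A B \<pi> \<sigma> u by fact
  have Hom: "Hom_space A (inflation (P n)) W = Hom_space B (P n) (corner W)" for n
    using linear_map_inflation_iff[OF P W] by (simp add: Hom_space_def scalars)
  have "cocycles A (\<lambda>n. inflation (P n)) d W m = cocycles B P d (corner W) m"
    by (simp add: cocycles_def Hom)
  moreover have "coboundaries A (\<lambda>n. inflation (P n)) d W m = coboundaries B P d (corner W) m"
    by (cases m) (simp_all add: Hom)
  ultimately show ?thesis by (simp add: Ext_def Hom)
qed

section \<open>The group algebra as a corner of the Drinfel'd double\<close>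

lemma (in abelian_monoid) finsum_reindex_support:
  assumes "finite T" "inj_on h I" "h ` I \<subseteq> T" "f \<in> T \<rightarrow> carrier G"
    and "\<And>p. p \<in> T \<Longrightarrow> p \<notin> h ` I \<Longrightarrow> f p = \<zero>"
  shows "(\<Oplus>p\<in>T. f p) = (\<Oplus>i\<in>I. f (h i))"
proof -
  have "(\<Oplus>p\<in>T. f p) = (\<Oplus>p\<in>h ` I. f p)"
    using assms by (intro add.finprod_mono_neutral_cong_right) auto
  also have "\<dots> = (\<Oplus>i\<in>I. f (h i))"
    using assms by (intro finsum_reindex) auto
  finally show ?thesis .
qed

lemma (in abelian_monoid) finsum_single_support:
  assumes "finite T" "i \<in> T" "f \<in> T \<rightarrow> carrier G"
    and "\<And>p. p \<in> T \<Longrightarrow> p \<noteq> i \<Longrightarrow> f p = \<zero>"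
  shows "(\<Oplus>p\<in>T. f p) = f i"
proof -
  have "(\<Oplus>p\<in>T. f p) = (\<Oplus>p\<in>{i}. f p)"
    using assms finsum_reindex_support[of T "\<lambda>p. p" "{i}" f] by auto
  then show ?thesis using assms by (auto simp: Pi_iff)
qed

locale finite_group_over_cring = K: cring K + G: group G
  for K :: "('k, 'r) ring_scheme" and G :: "('g, 's) monoid_scheme" +
  assumes finite_G: "finite (carrier G)"
begin

abbreviation D where "D \<equiv> drinfeld_double K G"
abbreviation KG where "KG \<equiv> group_algebra K G"

lemma double_simps:
  "carrier D = carrier G \<times> carrier G \<rightarrow>\<^sub>E carrier K"
  "\<one>\<^bsub>D\<^esub> = (\<lambda>(a, b)\<in>carrier G \<times> carrier G. if b = \<one>\<^bsub>G\<^esub> then \<one>\<^bsub>K\<^esub> else \<zero>\<^bsub>K\<^esub>)"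
  "x \<oplus>\<^bsub>D\<^esub> y = (\<lambda>p\<in>carrier G \<times> carrier G. x p \<oplus>\<^bsub>K\<^esub> y p)"
  "k \<odot>\<^bsub>D\<^esub> x = (\<lambda>p\<in>carrier G \<times> carrier G. k \<otimes>\<^bsub>K\<^esub> x p)"
  by (simp_all add: drinfeld_double_def based_algebra_def)

lemma group_algebra_simps:
  "carrier KG = carrier G \<rightarrow>\<^sub>E carrier K"
  "\<one>\<^bsub>KG\<^esub> = (\<lambda>b\<in>carrier G. if b = \<one>\<^bsub>G\<^esub> then \<one>\<^bsub>K\<^esub> else \<zero>\<^bsub>K\<^esub>)"
  "x \<oplus>\<^bsub>KG\<^esub> y = (\<lambda>b\<in>carrier G. x b \<oplus>\<^bsub>K\<^esub> y b)"
  "k \<odot>\<^bsub>KG\<^esub> x = (\<lambda>b\<in>carrier G. k \<otimes>\<^bsub>K\<^esub> x b)"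
  by (simp_all add: group_algebra_def based_algebra_def)

lemma solve_left: "b \<in> carrier G \<Longrightarrow> d \<in> carrier G \<Longrightarrow> inv\<^bsub>G\<^esub> b \<otimes>\<^bsub>G\<^esub> (b \<otimes>\<^bsub>G\<^esub> d) = d"
  "b \<in> carrier G \<Longrightarrow> d \<in> carrier G \<Longrightarrow> b \<otimes>\<^bsub>G\<^esub> (inv\<^bsub>G\<^esub> b \<otimes>\<^bsub>G\<^esub> d) = d"
  by (simp_all flip: G.m_assoc)

text \<open>
  The defining double sum over pairs of basis elements is supported on the pairs with product \<open>r\<close>, that
  is, on the pairs \<open>(b, b\<inverse> r)\<close>.
\<close>

lemma group_algebra_mult:
  assumes x: "x \<in> carrier KG" and y: "y \<in> carrier KG" and r: "r \<in> carrier G"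
  shows "(x \<otimes>\<^bsub>KG\<^esub> y) r = (\<Oplus>\<^bsub>K\<^esub>b\<in>carrier G. x b \<otimes>\<^bsub>K\<^esub> y (inv\<^bsub>G\<^esub> b \<otimes>\<^bsub>G\<^esub> r))"
proof -
  let ?f = "\<lambda>p. x (fst p) \<otimes>\<^bsub>K\<^esub> y (snd p) \<otimes>\<^bsub>K\<^esub>
    (if r = fst p \<otimes>\<^bsub>G\<^esub> snd p then \<one>\<^bsub>K\<^esub> else \<zero>\<^bsub>K\<^esub>)"
  let ?h = "\<lambda>b. (b, inv\<^bsub>G\<^esub> b \<otimes>\<^bsub>G\<^esub> r)"
  have x': "x b \<in> carrier K" and y': "y b \<in> carrier K" if "b \<in> carrier G" for b
    using x y that by (auto simp: group_algebra_simps)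
  have "(x \<otimes>\<^bsub>KG\<^esub> y) r = (\<Oplus>\<^bsub>K\<^esub>p\<in>carrier G \<times> carrier G. ?f p)"
    using r by (simp add: group_algebra_def based_algebra_def)
  also have "\<dots> = (\<Oplus>\<^bsub>K\<^esub>b\<in>carrier G. ?f (?h b))"
  proof (rule K.finsum_reindex_support)
    show "?f p = \<zero>\<^bsub>K\<^esub>" if "p \<in> carrier G \<times> carrier G" "p \<notin> ?h ` carrier G" for p
      using that x' y' by (cases p) (auto simp: image_iff solve_left)
  qed (use r finite_G x' y' in \<open>auto simp: inj_on_def\<close>)
  also have "\<dots> = (\<Oplus>\<^bsub>K\<^esub>b\<in>carrier G. x b \<otimes>\<^bsub>K\<^esub> y (inv\<^bsub>G\<^esub> b \<otimes>\<^bsub>G\<^esub> r))"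
    using r x' y' by (intro K.finsum_cong') (auto simp: solve_left)
  finally show ?thesis .
qed

text \<open>
  The product \<open>(\<delta>\<^sub>s \<otimes> b)(\<delta>\<^sub>c \<otimes> d)\<close> is \<open>\<delta>\<^sub>a \<otimes> r\<close> exactly for \<open>s = a\<close>, \<open>c = b\<inverse> a b\<close> and \<open>d = b\<inverse> r\<close>.
  For \<open>a = e\<close> the conjugation disappears and the formula becomes that of the group algebra.
\<close>

lemma double_mult:
  assumes x: "x \<in> carrier D" and y: "y \<in> carrier D" and a: "a \<in> carrier G" and r: "r \<in> carrier G"
  shows "(x \<otimes>\<^bsub>D\<^esub> y) (a, r) =
    (\<Oplus>\<^bsub>K\<^esub>b\<in>carrier G. x (a, b) \<otimes>\<^bsub>K\<^esub> y (inv\<^bsub>G\<^esub> b \<otimes>\<^bsub>G\<^esub> a \<otimes>\<^bsub>G\<^esub> b, inv\<^bsub>G\<^esub> b \<otimes>\<^bsub>G\<^esub> r))"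
proof -
  let ?c = "\<lambda>(a, b) (c, d) r.
    if a = b \<otimes>\<^bsub>G\<^esub> c \<otimes>\<^bsub>G\<^esub> inv\<^bsub>G\<^esub> b \<and> r = (a, b \<otimes>\<^bsub>G\<^esub> d) then \<one>\<^bsub>K\<^esub> else \<zero>\<^bsub>K\<^esub>"
  let ?f = "\<lambda>p. x (fst p) \<otimes>\<^bsub>K\<^esub> y (snd p) \<otimes>\<^bsub>K\<^esub> ?c (fst p) (snd p) (a, r)"
  let ?S = "carrier G \<times> carrier G"
  let ?h = "\<lambda>b. ((a, b), (inv\<^bsub>G\<^esub> b \<otimes>\<^bsub>G\<^esub> a \<otimes>\<^bsub>G\<^esub> b, inv\<^bsub>G\<^esub> b \<otimes>\<^bsub>G\<^esub> r))"
  have x': "x p \<in> carrier K" and y': "y p \<in> carrier K" if "p \<in> ?S" for p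
    using x y that by (auto simp: double_simps)
  have "(x \<otimes>\<^bsub>D\<^esub> y) (a, r) = (\<Oplus>\<^bsub>K\<^esub>p\<in>?S \<times> ?S. ?f p)"
    using a r by (simp add: drinfeld_double_def based_algebra_def)
  also have "\<dots> = (\<Oplus>\<^bsub>K\<^esub>b\<in>carrier G. ?f (?h b))"
  proof (rule K.finsum_reindex_support)
    show "?f p = \<zero>\<^bsub>K\<^esub>" if p: "p \<in> ?S \<times> ?S" "p \<notin> ?h ` carrier G" for p
    proof -
      obtain a' b c d where abcd: "p = ((a', b), (c, d))" by (metis prod.exhaust)
      then have in_G: "a' \<in> carrier G" "b \<in> carrier G" "c \<in> carrier G" "d \<in> carrier G"
        using p by auto
      have "\<not> (a' = b \<otimes>\<^bsub>G\<^esub> c \<otimes>\<^bsub>G\<^esub> inv\<^bsub>G\<^esub> b \<and> (a, r) = (a', b \<otimes>\<^bsub>G\<^esub> d))"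
      proof
        assume "a' = b \<otimes>\<^bsub>G\<^esub> c \<otimes>\<^bsub>G\<^esub> inv\<^bsub>G\<^esub> b \<and> (a, r) = (a', b \<otimes>\<^bsub>G\<^esub> d)"
        then have "p = ?h b" using in_G by (simp add: abcd G.m_assoc solve_left)
        then show False using p in_G by blast
      qed
      then show ?thesis using x' y' in_G by (auto simp: abcd)
    qed
    show "?f \<in> ?S \<times> ?S \<rightarrow> carrier K" using x' y' by (auto split: prod.split)
  qed (use a r finite_G in \<open>auto simp: inj_on_def\<close>)
  also have "\<dots> = (\<Oplus>\<^bsub>K\<^esub>b\<in>carrier G. x (a, b) \<otimes>\<^bsub>K\<^esub>
      y (inv\<^bsub>G\<^esub> b \<otimes>\<^bsub>G\<^esub> a \<otimes>\<^bsub>G\<^esub> b, inv\<^bsub>G\<^esub> b \<otimes>\<^bsub>G\<^esub> r))"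
    using a r x' y' by (intro K.finsum_cong') (auto simp: solve_left G.m_assoc)
  finally show ?thesis .
qed

text \<open>
  The \<open>K\<close>-linear extension of \<open>\<delta>\<^sub>a \<otimes> b \<mapsto> \<delta>\<^sub>a\<^sub>,\<^sub>e b\<close>.
\<close>

definition double_to_group :: "('g \<times> 'g \<Rightarrow> 'k) \<Rightarrow> 'g \<Rightarrow> 'k"
  where "double_to_group x = (\<lambda>b\<in>carrier G. x (\<one>\<^bsub>G\<^esub>, b))"

lemma double_eqI:
  assumes "x \<in> carrier D" "y \<in> carrier D"
    and "\<And>a b. a \<in> carrier G \<Longrightarrow> b \<in> carrier G \<Longrightarrow> x (a, b) = y (a, b)"
  shows "x = y"
  using assms by (intro PiE_ext[of x "carrier G \<times> carrier G" "\<lambda>_. carrier K"]) (auto simp: double_simps)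

lemma group_algebra_eqI:
  assumes "x \<in> carrier KG" "y \<in> carrier KG" "\<And>b. b \<in> carrier G \<Longrightarrow> x b = y b"
  shows "x = y"
  using assms by (intro PiE_ext[of x "carrier G" "\<lambda>_. carrier K"]) (auto simp: group_algebra_simps)

lemma double_basis_closed: "double_basis K G a b \<in> carrier D"
  by (auto simp: double_simps double_basis_def)

text \<open>
  The coefficients at \<open>\<delta>\<^sub>e \<otimes> b\<close> of a product involve only coefficients of this form, because conjugation
  fixes \<open>e\<close>. That \<open>D(G)\<close> and \<open>K[G]\<close> are rings is a hypothesis here and below, which any module over
  them supplies.
\<close>

lemma double_to_group_hom:
  assumes "ring D" "ring KG"
  shows "double_to_group \<in> ring_hom D KG"
proof (rule ring_hom_memI)
  interpret D: ring D by fact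
  interpret KG: ring KG by fact
  show closed: "double_to_group x \<in> carrier KG" if "x \<in> carrier D" for x
    using that by (auto simp: double_to_group_def double_simps group_algebra_simps)
  show "double_to_group (x \<otimes>\<^bsub>D\<^esub> y) = double_to_group x \<otimes>\<^bsub>KG\<^esub> double_to_group y"
    if xy: "x \<in> carrier D" "y \<in> carrier D" for x y
  proof (rule group_algebra_eqI)
    fix r assume r: "r \<in> carrier G"
    have "x (\<one>\<^bsub>G\<^esub>, b) \<in> carrier K" "y (\<one>\<^bsub>G\<^esub>, b) \<in> carrier K" if "b \<in> carrier G" for b
      using xy that by (auto simp: double_simps)
    then show "double_to_group (x \<otimes>\<^bsub>D\<^esub> y) r = (double_to_group x \<otimes>\<^bsub>KG\<^esub> double_to_group y) r"
      using r xy closed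
      by (simp add: double_mult group_algebra_mult double_to_group_def)
        (intro K.finsum_cong', auto)
  qed (use xy closed in auto)
  show "double_to_group (x \<oplus>\<^bsub>D\<^esub> y) = double_to_group x \<oplus>\<^bsub>KG\<^esub> double_to_group y" for x y
    by (auto simp: double_to_group_def double_simps group_algebra_simps)
  show "double_to_group \<one>\<^bsub>D\<^esub> = \<one>\<^bsub>KG\<^esub>"
    by (auto simp: double_to_group_def double_simps group_algebra_simps)
qed

text \<open>
  The coefficients of an element \<open>\<Sum>\<^sub>a \<delta>\<^sub>a \<otimes> b\<close> do not depend on \<open>a\<close>, so the conjugation in the product
  has no effect on them.
\<close>

lemma group_to_double_hom:
  assumes "ring D" "ring KG"
  shows "group_to_double G \<in> ring_hom KG D"
proof (rule ring_hom_memI)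
  interpret D: ring D by fact
  interpret KG: ring KG by fact
  show closed: "group_to_double G x \<in> carrier D" if "x \<in> carrier KG" for x
    using that by (auto simp: group_to_double_def double_simps group_algebra_simps)
  show "group_to_double G (x \<otimes>\<^bsub>KG\<^esub> y) = group_to_double G x \<otimes>\<^bsub>D\<^esub> group_to_double G y"
    if xy: "x \<in> carrier KG" "y \<in> carrier KG" for x y
  proof (rule double_eqI)
    fix a r assume r: "a \<in> carrier G" "r \<in> carrier G"
    have "x b \<in> carrier K" "y b \<in> carrier K" if "b \<in> carrier G" for b
      using xy that by (auto simp: group_algebra_simps)
    then show "group_to_double G (x \<otimes>\<^bsub>KG\<^esub> y) (a, r) =
        (group_to_double G x \<otimes>\<^bsub>D\<^esub> group_to_double G y) (a, r)"
      using r xy closed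
      by (simp add: double_mult group_algebra_mult group_to_double_def)
        (intro K.finsum_cong', auto)
  qed (use xy closed in auto)
  show "group_to_double G (x \<oplus>\<^bsub>KG\<^esub> y) = group_to_double G x \<oplus>\<^bsub>D\<^esub> group_to_double G y" for x y
    by (auto simp: group_to_double_def double_simps group_algebra_simps)
  show "group_to_double G \<one>\<^bsub>KG\<^esub> = \<one>\<^bsub>D\<^esub>"
    by (auto simp: group_to_double_def double_simps group_algebra_simps)
qed

text \<open>
  Multiplication by \<open>\<delta>\<^sub>e \<otimes> e\<close> from either side projects onto the span of the \<open>\<delta>\<^sub>e \<otimes> b\<close>, because
  conjugation fixes \<open>e\<close>. In particular this idempotent is central.
\<close>

lemma double_mult_unit_idempotent:
  assumes x: "x \<in> carrier D" and ar: "a \<in> carrier G" "r \<in> carrier G"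
  shows "(double_basis K G \<one>\<^bsub>G\<^esub> \<one>\<^bsub>G\<^esub> \<otimes>\<^bsub>D\<^esub> x) (a, r) = (if a = \<one>\<^bsub>G\<^esub> then x (a, r) else \<zero>\<^bsub>K\<^esub>)" (is ?left)
    and "(x \<otimes>\<^bsub>D\<^esub> double_basis K G \<one>\<^bsub>G\<^esub> \<one>\<^bsub>G\<^esub>) (a, r) = (if a = \<one>\<^bsub>G\<^esub> then x (a, r) else \<zero>\<^bsub>K\<^esub>)" (is ?right)
proof -
  let ?u = "double_basis K G \<one>\<^bsub>G\<^esub> \<one>\<^bsub>G\<^esub>"
  have x': "x p \<in> carrier K" if "p \<in> carrier G \<times> carrier G" for p
    using x that by (auto simp: double_simps)
  have u: "?u p = (if p = (\<one>\<^bsub>G\<^esub>, \<one>\<^bsub>G\<^esub>) then \<one>\<^bsub>K\<^esub> else \<zero>\<^bsub>K\<^esub>)" if "p \<in> carrier G \<times> carrier G" for p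
    using that by (simp add: double_basis_def)
  have "(?u \<otimes>\<^bsub>D\<^esub> x) (a, r) = ?u (a, \<one>\<^bsub>G\<^esub>) \<otimes>\<^bsub>K\<^esub>
      x (inv\<^bsub>G\<^esub> \<one>\<^bsub>G\<^esub> \<otimes>\<^bsub>G\<^esub> a \<otimes>\<^bsub>G\<^esub> \<one>\<^bsub>G\<^esub>, inv\<^bsub>G\<^esub> \<one>\<^bsub>G\<^esub> \<otimes>\<^bsub>G\<^esub> r)"
    unfolding double_mult[OF double_basis_closed x ar]
    by (rule K.finsum_single_support) (use finite_G x' u ar in auto)
  then show ?left using x' u ar by simp
  have "(x \<otimes>\<^bsub>D\<^esub> ?u) (a, r) = x (a, r) \<otimes>\<^bsub>K\<^esub>
      ?u (inv\<^bsub>G\<^esub> r \<otimes>\<^bsub>G\<^esub> a \<otimes>\<^bsub>G\<^esub> r, inv\<^bsub>G\<^esub> r \<otimes>\<^bsub>G\<^esub> r)"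
    unfolding double_mult[OF x double_basis_closed ar]
  proof (rule K.finsum_single_support)
    fix b assume b: "b \<in> carrier G" "b \<noteq> r"
    then have "inv\<^bsub>G\<^esub> b \<otimes>\<^bsub>G\<^esub> r \<noteq> \<one>\<^bsub>G\<^esub>" using ar by (metis G.inv_closed G.r_one solve_left(2))
    then show "x (a, b) \<otimes>\<^bsub>K\<^esub> ?u (inv\<^bsub>G\<^esub> b \<otimes>\<^bsub>G\<^esub> a \<otimes>\<^bsub>G\<^esub> b, inv\<^bsub>G\<^esub> b \<otimes>\<^bsub>G\<^esub> r) = \<zero>\<^bsub>K\<^esub>"
      using x' u ar b by simp
  qed (use finite_G x' u ar in auto)
  moreover have "inv\<^bsub>G\<^esub> r \<otimes>\<^bsub>G\<^esub> a \<otimes>\<^bsub>G\<^esub> r = \<one>\<^bsub>G\<^esub> \<longleftrightarrow> a = \<one>\<^bsub>G\<^esub>"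
    using ar by (metis G.inv_closed G.inv_solve_left G.l_inv G.m_assoc G.m_closed G.r_one G.r_cancel G.l_one)
  ultimately show ?right using x' u ar by simp
qed

lemma central_corner_double:
  assumes "ring D" "ring KG"
  shows "central_corner D KG double_to_group (group_to_double G) (double_basis K G \<one>\<^bsub>G\<^esub> \<one>\<^bsub>G\<^esub>)"
proof -
  interpret D: ring D by fact
  interpret KG: ring KG by fact
  note \<pi> = double_to_group_hom[OF assms] and \<sigma> = group_to_double_hom[OF assms]
  let ?u = "double_basis K G \<one>\<^bsub>G\<^esub> \<one>\<^bsub>G\<^esub>"
  note u = double_basis_closed[of "\<one>\<^bsub>G\<^esub>" "\<one>\<^bsub>G\<^esub>"]
  show ?thesis
  proof (unfold_locales)
    show "double_to_group (group_to_double G x) = x" if "x \<in> carrier KG" for x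
      using that by (auto simp: double_to_group_def group_to_double_def group_algebra_simps
          PiE_def extensional_def fun_eq_iff)
    show "double_to_group ?u = \<one>\<^bsub>KG\<^esub>"
      by (auto simp: double_to_group_def double_basis_def group_algebra_simps)
    show "?u \<otimes>\<^bsub>D\<^esub> x = x \<otimes>\<^bsub>D\<^esub> ?u" if "x \<in> carrier D" for x
      using that u by (intro double_eqI) (auto simp: double_mult_unit_idempotent)
    show "group_to_double G (double_to_group x) \<otimes>\<^bsub>D\<^esub> ?u = x \<otimes>\<^bsub>D\<^esub> ?u" if x: "x \<in> carrier D" for x
    proof (rule double_eqI)
      have closed: "group_to_double G (double_to_group x) \<in> carrier D"
        using x by (intro ring_hom_closed[OF \<sigma>] ring_hom_closed[OF \<pi>])
      then show "group_to_double G (double_to_group x) \<otimes>\<^bsub>D\<^esub> ?u \<in> carrier D" "x \<otimes>\<^bsub>D\<^esub> ?u \<in> carrier D"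
        using x u by auto
      show "(group_to_double G (double_to_group x) \<otimes>\<^bsub>D\<^esub> ?u) (a, b) = (x \<otimes>\<^bsub>D\<^esub> ?u) (a, b)"
        if "a \<in> carrier G" "b \<in> carrier G" for a b
        using that x closed
        by (simp add: double_mult_unit_idempotent) (simp add: group_to_double_def double_to_group_def)
    qed
  qed (use \<pi> \<sigma> u in auto)
qed

text \<open>
  The coefficient of \<open>k.1\<close> at \<open>\<delta>\<^sub>a \<otimes> b\<close> vanishes unless \<open>b = e\<close>, so a product with \<open>k.1\<close> has a single
  nonzero summand: \<open>b = e\<close> when \<open>k.1\<close> is on the left and \<open>b = r\<close> when it is on the right.
\<close>

lemma central_scalars_double:
  assumes "ring D"
  shows "central_scalars K D"
proof -
  interpret D: ring D by fact
  have one: "(k \<odot>\<^bsub>D\<^esub> \<one>\<^bsub>D\<^esub>) (a, b) = (if b = \<one>\<^bsub>G\<^esub> then k else \<zero>\<^bsub>K\<^esub>)"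
    if "k \<in> carrier K" "a \<in> carrier G" "b \<in> carrier G" for k a b
    using that by (simp add: double_simps)
  have closed: "k \<odot>\<^bsub>D\<^esub> \<one>\<^bsub>D\<^esub> \<in> carrier D" if "k \<in> carrier K" for k
    using that by (auto simp: double_simps)
  have "(k \<odot>\<^bsub>D\<^esub> \<one>\<^bsub>D\<^esub>) \<otimes>\<^bsub>D\<^esub> x = x \<otimes>\<^bsub>D\<^esub> (k \<odot>\<^bsub>D\<^esub> \<one>\<^bsub>D\<^esub>)" if k: "k \<in> carrier K" and x: "x \<in> carrier D" for k x
  proof (rule double_eqI)
    fix a r assume ar: "a \<in> carrier G" "r \<in> carrier G"
    have x': "x p \<in> carrier K" if "p \<in> carrier G \<times> carrier G" for p
      using x that by (auto simp: double_simps)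
    have "((k \<odot>\<^bsub>D\<^esub> \<one>\<^bsub>D\<^esub>) \<otimes>\<^bsub>D\<^esub> x) (a, r) = (k \<odot>\<^bsub>D\<^esub> \<one>\<^bsub>D\<^esub>) (a, \<one>\<^bsub>G\<^esub>) \<otimes>\<^bsub>K\<^esub>
        x (inv\<^bsub>G\<^esub> \<one>\<^bsub>G\<^esub> \<otimes>\<^bsub>G\<^esub> a \<otimes>\<^bsub>G\<^esub> \<one>\<^bsub>G\<^esub>, inv\<^bsub>G\<^esub> \<one>\<^bsub>G\<^esub> \<otimes>\<^bsub>G\<^esub> r)"
      unfolding double_mult[OF closed[OF k] x ar]
      by (rule K.finsum_single_support) (use finite_G x' k one ar in auto)
    also have "\<dots> = k \<otimes>\<^bsub>K\<^esub> x (a, r)" using k ar by (simp add: one)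
    also have "\<dots> = x (a, r) \<otimes>\<^bsub>K\<^esub> (k \<odot>\<^bsub>D\<^esub> \<one>\<^bsub>D\<^esub>)
        (inv\<^bsub>G\<^esub> r \<otimes>\<^bsub>G\<^esub> a \<otimes>\<^bsub>G\<^esub> r, inv\<^bsub>G\<^esub> r \<otimes>\<^bsub>G\<^esub> r)"
      using k ar x' by (simp add: one K.m_comm)
    also have "\<dots> = (x \<otimes>\<^bsub>D\<^esub> (k \<odot>\<^bsub>D\<^esub> \<one>\<^bsub>D\<^esub>)) (a, r)"
      unfolding double_mult[OF x closed[OF k] ar]
    proof (rule K.finsum_single_support[symmetric])
      fix b assume b: "b \<in> carrier G" "b \<noteq> r"
      then have "inv\<^bsub>G\<^esub> b \<otimes>\<^bsub>G\<^esub> r \<noteq> \<one>\<^bsub>G\<^esub>" using ar by (metis G.inv_closed G.r_one solve_left(2))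
      then show "x (a, b) \<otimes>\<^bsub>K\<^esub> (k \<odot>\<^bsub>D\<^esub> \<one>\<^bsub>D\<^esub>) (inv\<^bsub>G\<^esub> b \<otimes>\<^bsub>G\<^esub> a \<otimes>\<^bsub>G\<^esub> b, inv\<^bsub>G\<^esub> b \<otimes>\<^bsub>G\<^esub> r) = \<zero>\<^bsub>K\<^esub>"
        using x' k ar b by (simp add: one)
    qed (use finite_G x' k one ar in auto)
    finally show "((k \<odot>\<^bsub>D\<^esub> \<one>\<^bsub>D\<^esub>) \<otimes>\<^bsub>D\<^esub> x) (a, r) = (x \<otimes>\<^bsub>D\<^esub> (k \<odot>\<^bsub>D\<^esub> \<one>\<^bsub>D\<^esub>)) (a, r)" .
  qed (use closed k x in auto)
  then show ?thesis using closed by unfold_locales auto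
qed

text \<open>
  The counit of the double factors through the group algebra; so the trivial module of the double is
  the inflation of the trivial module of the group.
\<close>

lemma double_counit_eq:
  assumes x: "x \<in> carrier D"
  shows "double_counit K G x = group_counit K G (double_to_group x)"
proof -
  have x': "x p \<in> carrier K" if "p \<in> carrier G \<times> carrier G" for p
    using x that by (auto simp: double_simps)
  have "double_counit K G x = (\<Oplus>\<^bsub>K\<^esub>b\<in>carrier G. x (\<one>\<^bsub>G\<^esub>, b) \<otimes>\<^bsub>K\<^esub>
      (if fst (\<one>\<^bsub>G\<^esub>, b) = \<one>\<^bsub>G\<^esub> then \<one>\<^bsub>K\<^esub> else \<zero>\<^bsub>K\<^esub>))"
    unfolding double_counit_def
    by (rule K.finsum_reindex_support) (use finite_G x' in \<open>auto simp: inj_on_def image_iff\<close>)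
  also have "\<dots> = group_counit K G (double_to_group x)"
    unfolding group_counit_def double_to_group_def
    using x' by (intro K.finsum_cong') auto
  finally show ?thesis .
qed

end

section \<open>Ext over the double as group cohomology\<close>

theorem proposition5p3:
  fixes K :: "('k, 'r) ring_scheme"
    and G :: "('g, 's) monoid_scheme"
    and W :: "('g \<times> 'g \<Rightarrow> 'k, 'w) module"
    and P :: "nat \<Rightarrow> ('g \<times> 'g \<Rightarrow> 'k, 'p) module" and dP :: "nat \<Rightarrow> 'p \<Rightarrow> 'p" and p :: "'p \<Rightarrow> 'k"
    and Q :: "nat \<Rightarrow> ('g \<Rightarrow> 'k, 'q) module" and dQ :: "nat \<Rightarrow> 'q \<Rightarrow> 'q" and q :: "'q \<Rightarrow> 'k"
    and m :: nat
  assumes "algebraically_closed K"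
    and "group G" and "finite (carrier G)"
    and "left_module (drinfeld_double K G) W"
    and "projective_resolution (drinfeld_double K G) (double_trivial K G) P dP p"
    and "projective_resolution (group_algebra K G) (group_trivial K G) Q dQ q"
  shows "isomorphic_modules K
    (Ext (drinfeld_double K G) P dP W m)
    (group_cohomology K G Q dQ (unit_component K G W) m)"
proof -
  interpret K: algebraically_closed K by fact
  interpret G: group G by fact
  interpret finite_group_over_cring K G
    by (intro finite_group_over_cring.intro finite_group_over_cring_axioms.intro
        K.cring_axioms G.group_axioms assms(3))
  note W = assms(4) and P = assms(5) and Q = assms(6)
  interpret W: left_module D W by (rule W)
  note Q' = projective_resolutionD[OF Q]
  interpret Q: left_module KG "Q 0" by (rule Q'(3))
  note is_corner = central_corner_double[OF W.A.ring_axioms Q.A.ring_axioms]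
  interpret central_corner D KG double_to_group "group_to_double G" "double_basis K G \<one>\<^bsub>G\<^esub> \<one>\<^bsub>G\<^esub>"
    by (rule is_corner)
  interpret central_scalars K D by (rule central_scalars_double[OF W.A.ring_axioms])
  have "linear_map D (inflation (Q 0)) (double_trivial K G) q"
    using Q'(4) ring_hom_closed[OF \<pi>]
    by (auto simp: linear_map_def double_trivial_def group_trivial_def trivial_module_def double_counit_eq)
  then have "projective_resolution D (double_trivial K G) (\<lambda>n. inflation (Q n)) dQ q"
    by (intro projective_resolution_inflation[OF Q projective_resolutionD(1)[OF P]])
      (simp_all add: double_trivial_def group_trivial_def trivial_module_def)
  then have "isomorphic_modules K (Ext D P dP W m) (Ext D (\<lambda>n. inflation (Q n)) dQ W m)"
    by (rule Ext_independent_of_resolution[OF P _ W])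
  also have "Ext D (\<lambda>n. inflation (Q n)) dQ W m = Ext KG Q dQ (corner W) m"
  proof (rule Ext_inflation[OF is_corner _ Q'(3) W])
    show "group_to_double G (k \<odot>\<^bsub>KG\<^esub> \<one>\<^bsub>KG\<^esub>) = k \<odot>\<^bsub>D\<^esub> \<one>\<^bsub>D\<^esub>" for k
      by (auto simp: group_to_double_def double_simps group_algebra_simps)
  qed
  also have "corner W = unit_component K G W"
    by (simp add: unit_component_def restrict_scalars_def fixed_part_def)
  finally show ?thesis by (simp add: group_cohomology_def)
qed

end
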